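(* For every ordinal $\alpha<\omega_1$, there is a finitely generated group $G$ satisfying the maximal condition on normal subgroups such that $\rho(T_G)\geq\alpha$, where $T_G$ is the normal subgroup tree of $G$.
   Context: Let $\mathbb{F}_\omega$ be the free group on countably many letters, with a fixed enumeration $(\gamma_i)_{i\in\mathbb{N}}$ of its elements. A marked group is $G=\mathbb{F}_\omega/N$ with $N\trianglelefteq\mathbb{F}_\omega$; it carries the enumeration $g_i:=\gamma_iN$, $i\in\mathbb{N}$ (repetitions allowed). For $s=(s_0,\dots,s_n)\in\mathbb{N}^{<\mathbb{N}}$ write $\{g_s\}=\{g_{s_0},\dots,g_{s_n}\}$, with $\{g_\emptyset\}=\emptyset$. $\langle\langle S\rangle\rangle$ denotes the normal closure of $S$ in $G$. $G$ satisfies the maximal condition on normal subgroups if there is no infinite strictly increasing chain of normal subgroups of $G$. The normal subgroup tree $T_G\subseteq\mathbb{N}^{<\mathbb{N}}$ is defined recursively, writing $(s,i)$ for the sequence $s$ extended by the term $i$: $\emptyset\in T_G$; and if $s\in T_G$ and $i\in\mathbb{N}$, then $(s,i)\in T_G$ if and only if $\langle\langle\{g_s\}\cup\{g_i\}\rangle\rangle\ne\langle\langle\{g_s\}\rangle\rangle$ (where $\langle\langle\emptyset\rangle\rangle=\{e\}$). The value $\rho(T_G)$ does not depend on the marking of $G$. A tree is a set $T\subseteq\mathbb{N}^{<\mathbb{N}}$ closed under initial segments; it is well-founded if there is no $x\in\mathbb{N}^{\mathbb{N}}$ all of whose finite initial segments lie in $T$. For a nonempty well-founded tree $T$, define $\rho_T(t)=\sup\{\rho_T(s)+1\mid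 s\in T,\ t\subsetneq s\}$ (so $\rho_T(t)=0$ if $t$ has no proper extension in $T$) and $\rho(T)=\rho_T(\emptyset)+1$; put $\rho(\emptyset)=0$, and $\rho(T)=\omega_1$ if $T$ is not well-founded. *)

theory Defs
  imports
    "HOL-Library.Countable_Set"
    "HOL-Library.Sublist"
    "HOL-Algebra.Coset"
    "HOL-Algebra.Generated_Groups"
begin

unbundle cardinal_syntax

section \<open>Ordinals\<close>

text \<open>
  Isomorphism classes of well-orders whose field is a set of subsets of \<open>nat\<close>. This type contains
  every ordinal of cardinality at most the continuum, in particular \<open>\<omega>\<^sub>1\<close> and its successor; see
  \<open>ordinal_strict_bound\<close> below.
\<close>

quotient_type ordinal = "nat set rel" / partial: "\<lambda>r s. r =o s"
  morphisms rep_ordinal abs_ordinal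
proof (rule part_equivpI)
  have "Well_order ({} :: nat set rel)"
    by (simp add: order_on_defs)
  then show "\<exists>r :: nat set rel. r =o r"
    using ordIso_reflexive by blast
  show "symp (\<lambda>r s :: nat set rel. r =o s)"
    by (auto intro: sympI ordIso_symmetric)
  show "transp (\<lambda>r s :: nat set rel. r =o s)"
    by (auto intro: transpI ordIso_transitive)
qed

lemma ordIso_Well_order: "r =o s \<Longrightarrow> Well_order r \<and> Well_order s"
  by (simp add: ordIso_def)

instantiation ordinal :: linorder
begin

lift_definition less_eq_ordinal :: "ordinal \<Rightarrow> ordinal \<Rightarrow> bool" is "\<lambda>r s. r \<le>o s"
  by (meson ordIso_iff_ordLeq ordLeq_transitive)

lift_definition less_ordinal :: "ordinal \<Rightarrow> ordinal \<Rightarrow> bool" is "\<lambda>r s. r <o s"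
  by (meson ordIso_ordLess_trans ordIso_symmetric ordLess_ordIso_trans)

instance
proof
  fix x y z :: ordinal
  show "(x < y) = (x \<le> y \<and> \<not> y \<le> x)"
    by transfer (meson not_ordLess_ordLeq not_ordLeq_iff_ordLess ordIso_Well_order ordLess_imp_ordLeq)
  show "x \<le> x"
    by transfer (simp add: ordIso_imp_ordLeq)
  show "x \<le> y \<Longrightarrow> y \<le> z \<Longrightarrow> x \<le> z"
    by transfer (rule ordLeq_transitive)
  show "x \<le> y \<Longrightarrow> y \<le> x \<Longrightarrow> x = y"
    by transfer (simp add: ordIso_iff_ordLeq)
  show "x \<le> y \<or> y \<le> x"
    by transfer (simp add: ordIso_Well_order ordLeq_total)
qed

end

instance ordinal :: wellorder
proof
  fix P :: "ordinal \<Rightarrow> bool" and a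
  assume step: "\<And>x. (\<And>y. y < x \<Longrightarrow> P y) \<Longrightarrow> P x"
  have "{(x, y). x < y} \<subseteq> inv_image ordLess rep_ordinal"
    by (auto simp: less_ordinal_def map_fun_def)
  then have "wf {(x :: ordinal, y). x < y}"
    using wf_inv_image[OF wf_ordLess] wf_subset by blast
  then show "P a"
    by (induction a rule: wf_induct_rule) (use step in blast)
qed

lemma ordinal_cases:
  obtains r where "Well_order r" "a = abs_ordinal r"
proof
  show "Well_order (rep_ordinal a)"
    using Quotient_rep_reflp[OF Quotient_ordinal] by (simp add: ordIso_def)
  show "a = abs_ordinal (rep_ordinal a)"
    by (simp add: Quotient_abs_rep[OF Quotient_ordinal])
qed

lemma abs_ordinal_empty_le: "abs_ordinal {} \<le> a"
proof -
  obtain r where r: "Well_order r" "a = abs_ordinal r" by (rule ordinal_cases)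
  have w: "Well_order ({} :: nat set rel)" by (simp add: order_on_defs)
  have "\<exists>f. embed {} r f" by (simp add: embed_def)
  then have "{} \<le>o r" using r(1) w by (simp add: ordLeq_def)
  then show ?thesis
    unfolding r(2) using w r(1) by (simp add: less_eq_ordinal.abs_eq ordIso_reflexive)
qed

text \<open>As in any well-order, \<open>Sup X\<close> is the least upper bound whenever \<open>X\<close> is bounded above, and
  \<open>Sup {} = 0\<close>.\<close>

instantiation ordinal :: "{zero, order_bot, conditionally_complete_linorder}"
begin

definition zero_ordinal :: ordinal where "0 = abs_ordinal {}"
definition bot_ordinal :: ordinal where "bot = (0 :: ordinal)"
definition inf_ordinal :: "ordinal \<Rightarrow> ordinal \<Rightarrow> ordinal" where "inf a b = min a (b :: ordinal)"
definition sup_ordinal :: "ordinal \<Rightarrow> ordinal \<Rightarrow> ordinal" where "sup a b = max a (b :: ordinal)"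
definition Inf_ordinal :: "ordinal set \<Rightarrow> ordinal" where "Inf X = (LEAST a :: ordinal. a \<in> X)"
definition Sup_ordinal :: "ordinal set \<Rightarrow> ordinal" where "Sup X = (LEAST b :: ordinal. \<forall>a\<in>X. a \<le> b)"

instance
proof
  fix x y z :: ordinal and X :: "ordinal set"
  show "inf x y \<le> x" "inf x y \<le> y" "x \<le> sup x y" "y \<le> sup x y"
    by (simp_all add: inf_ordinal_def sup_ordinal_def)
  show "x \<le> y \<Longrightarrow> x \<le> z \<Longrightarrow> x \<le> inf y z" "y \<le> x \<Longrightarrow> z \<le> x \<Longrightarrow> sup y z \<le> x"
    by (simp_all add: inf_ordinal_def sup_ordinal_def)
  show "x \<in> X \<Longrightarrow> Inf X \<le> x"
    by (simp add: Inf_ordinal_def Least_le)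
  show "X \<noteq> {} \<Longrightarrow> (\<And>x. x \<in> X \<Longrightarrow> z \<le> x) \<Longrightarrow> z \<le> Inf X"
  proof -
    assume "X \<noteq> {}" and z: "\<And>x. x \<in> X \<Longrightarrow> z \<le> x"
    then have "\<exists>a. a \<in> X" by blast
    then have "Inf X \<in> X" unfolding Inf_ordinal_def by (rule LeastI_ex)
    then show "z \<le> Inf X" by (rule z)
  qed
  show "x \<in> X \<Longrightarrow> bdd_above X \<Longrightarrow> x \<le> Sup X"
  proof -
    assume "x \<in> X" "bdd_above X"
    then obtain M where "\<forall>a\<in>X. a \<le> M" by (auto simp: bdd_above_def)
    then have "\<forall>a\<in>X. a \<le> Sup X" unfolding Sup_ordinal_def by (rule LeastI)
    with \<open>x \<in> X\<close> show "x \<le> Sup X" by blast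
  qed
  show "X \<noteq> {} \<Longrightarrow> (\<And>x. x \<in> X \<Longrightarrow> x \<le> z) \<Longrightarrow> Sup X \<le> z"
    unfolding Sup_ordinal_def by (rule Least_le) blast
  show "bot \<le> x"
    unfolding bot_ordinal_def zero_ordinal_def by (rule abs_ordinal_empty_le)
qed

end

lemma Sup_ordinal_empty: "Sup {} = (0 :: ordinal)"
  unfolding Sup_ordinal_def
  by (rule Least_equality) (simp_all flip: bot_ordinal_def)

definition osucc :: "ordinal \<Rightarrow> ordinal"
  where "osucc a = (LEAST b. a < b)"

definition omega1 :: ordinal
  where "omega1 = (LEAST a. uncountable {..<a})"

text \<open>
  The remainder of this section shows that the least elements above are taken over nonempty sets:
  \<open>{..<a}\<close> has order type \<open>a\<close>, successors are strictly larger, \<open>\<omega>\<^sub>1\<close> is the least uncountable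
  ordinal, and countable sets of ordinals are bounded.
\<close>

definition ordinal_rel :: "ordinal set \<Rightarrow> ordinal rel"
  where "ordinal_rel A = {(a, b). a \<in> A \<and> b \<in> A \<and> a \<le> b}"

lemma Field_ordinal_rel [simp]: "Field (ordinal_rel A) = A"
  by (auto simp: ordinal_rel_def Field_def)

lemma Well_order_ordinal_rel: "Well_order (ordinal_rel A)"
proof -
  have "wf {(x :: ordinal, y). x < y}" by (rule wf)
  then have "wf (ordinal_rel A - Id)"
    by (rule wf_subset) (auto simp: ordinal_rel_def)
  then have "well_order_on A (ordinal_rel A)"
    unfolding order_on_defs
    by (auto simp: ordinal_rel_def refl_on_def trans_def antisym_def total_on_def)
  then show ?thesis by simp
qed

lemma Restr_ordinal_rel: "B \<subseteq> A \<Longrightarrow> Restr (ordinal_rel A) B = ordinal_rel B"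
  by (auto simp: ordinal_rel_def)

lemma ofilter_ordinal_rel:
  assumes "B \<subseteq> A" and "\<And>x y. x \<in> B \<Longrightarrow> y \<le> x \<Longrightarrow> y \<in> B"
  shows "wo_rel.ofilter (ordinal_rel A) B"
proof -
  have "wo_rel (ordinal_rel A)" unfolding wo_rel_def by (rule Well_order_ordinal_rel)
  then show ?thesis
    using assms by (auto simp: wo_rel.ofilter_def under_def) (auto simp: ordinal_rel_def)
qed

lemma abs_ordinal_less_iff:
  assumes "Well_order r" "Well_order s"
  shows "abs_ordinal r < abs_ordinal s \<longleftrightarrow> r <o s"
  using less_ordinal.abs_eq ordIso_reflexive assms by blast

lemma ordinal_rel_lessThan:
  assumes "Well_order r"
  shows "r =o ordinal_rel {..<abs_ordinal r}"
proof -
  define h where "h a = abs_ordinal (Restr r (underS r a))" for a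
  have wo: "wo_rel r" by (simp add: wo_rel_def assms)
  have W: "Well_order (Restr r (underS r a))" for a
    by (rule Well_order_Restr[OF assms])
  have total: "(a, b) \<in> r \<or> (b, a) \<in> r" if "a \<in> Field r" "b \<in> Field r" for a b
    using wo_rel.TOTALS[OF wo] that by blast
  have less: "h a < h b" if "(a, b) \<in> r" "a \<noteq> b" for a b
  proof -
    have "underS r a \<subset> underS r b"
      unfolding psubset_eq
    proof
      show "underS r a \<subseteq> underS r b"
        using that underS_incl_iff[OF wo_rel.LIN[OF wo], of a b] by (auto simp: Field_def)
      have "a \<in> underS r b" "a \<notin> underS r a"
        using that by (auto simp: underS_def)
      then show "underS r a \<noteq> underS r b" by blast
    qed
    then show ?thesis
      unfolding h_def
      unfolding abs_ordinal_less_iff[OF W W]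
      using ofilter_subset_ordLess[OF assms wo_rel.underS_ofilter[OF wo] wo_rel.underS_ofilter[OF wo]]
      by blast
  qed
  have "bij_betw h (Field r) {..<abs_ordinal r}"
  proof (rule bij_betwI')
    fix a b assume ab: "a \<in> Field r" "b \<in> Field r"
    show "h a = h b \<longleftrightarrow> a = b"
      using less[of a b] less[of b a] total[OF ab] by (metis order_less_irrefl)
  next
    fix a assume "a \<in> Field r"
    then show "h a \<in> {..<abs_ordinal r}"
      unfolding h_def
      using abs_ordinal_less_iff[OF W assms] underS_Restr_ordLess[OF assms] by auto
  next
    fix y assume y: "y \<in> {..<abs_ordinal r}"
    obtain s where s: "Well_order s" "y = abs_ordinal s" by (rule ordinal_cases)
    then have "s <o r" using y assms by (simp add: abs_ordinal_less_iff)
    then obtain a where "a \<in> Field r" "s =o Restr r (underS r a)"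
      using ordLess_iff_ordIso_Restr[OF assms s(1)] by blast
    moreover from this(2) have "y = h a"
      unfolding h_def s(2) by (rule Quotient_rel_abs[OF Quotient_ordinal])
    ultimately show "\<exists>a\<in>Field r. y = h a" by blast
  qed
  moreover have "(a, b) \<in> r \<longleftrightarrow> (h a, h b) \<in> ordinal_rel {..<abs_ordinal r}"
    if "a \<in> Field r" "b \<in> Field r" for a b
  proof -
    have "h a \<in> {..<abs_ordinal r}" "h b \<in> {..<abs_ordinal r}"
      using calculation that by (auto simp: bij_betw_def)
    moreover have "(a, b) \<in> r \<longleftrightarrow> h a \<le> h b"
      using less[of a b] less[of b a] total[OF that] total[OF that(1) that(1)]
      by (metis leD order_less_imp_le order_refl)
    ultimately show ?thesis by (simp add: ordinal_rel_def)
  qed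
  ultimately have "BNF_Wellorder_Embedding.iso r (ordinal_rel {..<abs_ordinal r}) h"
    unfolding iso_iff2 by simp
  then show ?thesis
    unfolding ordIso_def using assms Well_order_ordinal_rel by blast
qed

lemma card_lessThan_ordinal: "|{..<a :: ordinal}| \<le>o |UNIV :: nat set set|"
proof -
  obtain r where r: "Well_order r" "a = abs_ordinal r" by (rule ordinal_cases)
  have "|{..<a}| =o |Field r|"
    using card_of_cong[OF ordinal_rel_lessThan[OF r(1)]] r(2) ordIso_symmetric by simp
  then show ?thesis
    using card_of_mono1[of "Field r" UNIV] ordIso_ordLeq_trans by blast
qed

theorem ordinal_strict_bound:
  fixes X :: "ordinal set"
  assumes "|X| \<le>o |UNIV :: nat set set|"
  shows "\<exists>b. \<forall>a\<in>X. a < b"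
proof -
  define U where "U = (\<Union>x\<in>X. {..x})"
  have inf: "infinite (UNIV :: nat set set)"
    by (metis Finite_Set.finite_set infinite_UNIV_nat)
  have "|{..x}| \<le>o |UNIV :: nat set set|" for x :: ordinal
  proof -
    have "|{x}| \<le>o |UNIV :: nat set set|"
      by (rule card_of_singl_ordLeq) simp
    moreover have "Cinfinite |UNIV :: nat set set|"
      using inf by (simp add: cinfinite_def card_of_card_order_on Field_card_of)
    ultimately have "|{..<x} \<union> {x}| \<le>o |UNIV :: nat set set|"
      by (rule Un_Cinfinite_bound[OF card_lessThan_ordinal])
    moreover have "{..<x} \<union> {x} = {..x}" by auto
    ultimately show ?thesis by simp
  qed
  then have "|U| \<le>o |UNIV :: nat set set|"
    unfolding U_def using card_of_UNION_ordLeq_infinite[OF inf assms] by blast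
  then obtain f :: "ordinal \<Rightarrow> nat set" where f: "inj_on f U"
    using card_of_ordLeq[of U "UNIV :: nat set set"] by auto
  define r where "r = dir_image (ordinal_rel U) f"
  have r: "ordinal_rel U =o r"
    unfolding r_def by (rule dir_image_ordIso[OF Well_order_ordinal_rel]) (simp add: f)
  have "a < abs_ordinal r" if "a \<in> X" for a
  proof -
    obtain s where s: "Well_order s" "a = abs_ordinal s" by (rule ordinal_cases)
    have a: "a \<in> U" using that by (auto simp: U_def)
    have sub: "{..<a} \<subset> U"
      using a by (auto simp: U_def)
    have o1: "wo_rel.ofilter (ordinal_rel U) {..<a}"
      using sub by (intro ofilter_ordinal_rel) auto
    have o2: "wo_rel.ofilter (ordinal_rel U) U"
      by (intro ofilter_ordinal_rel) (auto simp: U_def intro: order_trans)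
    have "ordinal_rel {..<a} <o ordinal_rel U"
      using ofilter_subset_ordLess[OF Well_order_ordinal_rel o1 o2] sub
      by (simp add: Restr_ordinal_rel psubset_imp_subset)
    then have "s <o r"
      using ordinal_rel_lessThan[OF s(1)] r s(2)
      by (metis ordIso_ordLess_trans ordLess_ordIso_trans)
    then show ?thesis
      using s r by (simp add: abs_ordinal_less_iff ordIso_Well_order)
  qed
  then show ?thesis by blast
qed

lemma less_osucc: "a < osucc a"
proof -
  have "|{a}| \<le>o |UNIV :: nat set set|"
    by (rule card_of_singl_ordLeq) simp
  then have "\<exists>b. a < b" using ordinal_strict_bound[of "{a}"] by blast
  then show ?thesis unfolding osucc_def by (rule LeastI_ex)
qed

lemma osucc_le_iff: "osucc a \<le> b \<longleftrightarrow> a < b"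
  using less_osucc[of a] by (auto simp: osucc_def intro: Least_le)

lemma countable_imp_bdd_above_ordinal:
  fixes X :: "ordinal set"
  assumes "countable X"
  shows "bdd_above X"
proof -
  obtain f :: "ordinal \<Rightarrow> nat" where "inj_on f X"
    using assms by (auto simp: countable_def)
  then have "inj_on (\<lambda>x. {f x}) X" by (auto simp: inj_on_def)
  then have "|X| \<le>o |UNIV :: nat set set|"
    using card_of_ordLeq[of X "UNIV :: nat set set"] by auto
  then show ?thesis
    using ordinal_strict_bound[of X] by (auto simp: bdd_above_def intro: less_imp_le)
qed

lemma uncountable_lessThan_omega1: "uncountable {..<omega1}"
proof -
  let ?r = "|UNIV :: nat set set|"
  have "?r =o ordinal_rel {..<abs_ordinal ?r}"
    by (rule ordinal_rel_lessThan[OF card_of_Well_order])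
  then have "|Field ?r| =o |{..<abs_ordinal ?r}|"
    using card_of_cong by fastforce
  then have "\<exists>f. bij_betw f (UNIV :: nat set set) {..<abs_ordinal ?r}"
    using card_of_ordIso by (metis Field_card_of)
  moreover have "uncountable (UNIV :: nat set set)"
    by (metis Cantors_theorem Pow_UNIV UNIV_not_empty uncountable_def)
  ultimately have "\<exists>a :: ordinal. uncountable {..<a}"
    by (metis bij_betw_imp_inj_on bij_betw_imp_surj_on countable_image_inj_on)
  then show ?thesis unfolding omega1_def by (rule LeastI_ex)
qed

lemma less_omega1_iff: "a < omega1 \<longleftrightarrow> countable {..<a}"
proof
  show "a < omega1 \<Longrightarrow> countable {..<a}"
    unfolding omega1_def using not_less_Least by blast
  show "countable {..<a} \<Longrightarrow> a < omega1"
    by (metis countable_subset leI lessThan_subset_iff uncountable_lessThan_omega1)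
qed


section \<open>Trees on the natural numbers and their rank\<close>

definition is_tree :: "nat list set \<Rightarrow> bool"
  where "is_tree T \<longleftrightarrow> (\<forall>t\<in>T. \<forall>s. prefix s t \<longrightarrow> s \<in> T)"

definition well_founded_tree :: "nat list set \<Rightarrow> bool"
  where "well_founded_tree T \<longleftrightarrow> \<not> (\<exists>x :: nat \<Rightarrow> nat. \<forall>n. map x [0..<n] \<in> T)"

text \<open>The recursion equation is \<open>node_rank_eq\<close> below; outside of well-founded trees the value of
  \<open>node_rank\<close> is irrelevant.\<close>

definition node_rank :: "nat list set \<Rightarrow> nat list \<Rightarrow> ordinal"
  where "node_rank T =
    wfrec {(s, t). s \<in> T \<and> strict_prefix t s}
      (\<lambda>\<rho> t. SUP s\<in>{s\<in>T. strict_prefix t s}. osucc (\<rho> s))"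

definition tree_rank :: "nat list set \<Rightarrow> ordinal"
  where "tree_rank T =
    (if T = {} then 0
     else if well_founded_tree T then osucc (node_rank T [])
     else omega1)"

lemma wf_tree_extension:
  assumes "is_tree T" "well_founded_tree T"
  shows "wf {(s, t). s \<in> T \<and> strict_prefix t s}"
  unfolding wf_iff_no_infinite_down_chain
proof
  assume "\<exists>f. \<forall>i. (f (Suc i), f i) \<in> {(s, t). s \<in> T \<and> strict_prefix t s}"
  then obtain f where f: "\<And>i. f (Suc i) \<in> T" "\<And>i. strict_prefix (f i) (f (Suc i))"
    by auto
  have mono: "prefix (f i) (f j)" if "i \<le> j" for i j
    using that by (induction rule: dec_induct) (use f(2) prefix_order.less_imp_le prefix_order.trans in blast)+
  have len: "i \<le> length (f i)" for i
  proof (induction i)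
    case (Suc i)
    then show ?case using prefix_length_less[OF f(2)[of i]] by simp
  qed simp
  define x where "x n = f (Suc n) ! n" for n
  have "map x [0..<n] = take n (f (Suc n))" for n
  proof (rule nth_equalityI)
    show "length (map x [0..<n]) = length (take n (f (Suc n)))"
      using len[of "Suc n"] by simp
    fix i assume "i < length (map x [0..<n])"
    then have i: "i < n" by simp
    obtain v where "f (Suc n) = f (Suc i) @ v"
      using mono[of "Suc i" "Suc n"] i by (auto elim: prefixE)
    then show "map x [0..<n] ! i = take n (f (Suc n)) ! i"
      using i len[of "Suc i"] by (simp add: x_def nth_append)
  qed
  then have "map x [0..<n] \<in> T" for n
    using f(1)[of n] assms(1) take_is_prefix unfolding is_tree_def by metis
  then show False using assms(2) unfolding well_founded_tree_def by blast
qed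

lemma node_rank_eq:
  assumes "is_tree T" "well_founded_tree T"
  shows "node_rank T t = (SUP s\<in>{s\<in>T. strict_prefix t s}. osucc (node_rank T s))"
  unfolding node_rank_def
  by (subst wfrec[OF wf_tree_extension[OF assms]])
     (auto intro!: arg_cong[where f = Sup] image_cong simp: cut_apply)

lemma bdd_above_node_rank: "bdd_above ((\<lambda>s. osucc (node_rank T s)) ` A)"
  by (rule countable_imp_bdd_above_ordinal) simp


section \<open>The free group on countably many letters\<close>

text \<open>The letter \<open>(n, True)\<close> stands for the \<open>n\<close>-th free generator, \<open>(n, False)\<close> for its inverse; group
  elements are the reduced words.\<close>

type_synonym letter = "nat \<times> bool"

definition letter_inv :: "letter \<Rightarrow> letter"
  where "letter_inv x = (fst x, \<not> snd x)"

definition reduced :: "letter list \<Rightarrow> bool"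
  where "reduced w \<longleftrightarrow> successively (\<lambda>x y. y \<noteq> letter_inv x) w"

definition cons_reduce :: "letter \<Rightarrow> letter list \<Rightarrow> letter list"
  where "cons_reduce x w =
    (case w of [] \<Rightarrow> [x] | y # v \<Rightarrow> if y = letter_inv x then v else x # w)"

definition free_group_omega :: "letter list monoid"
  where "free_group_omega =
    \<lparr>carrier = {w. reduced w}, mult = (\<lambda>u v. foldr cons_reduce u v), one = []\<rparr>"

lemma letter_inv_letter_inv [simp]: "letter_inv (letter_inv x) = x"
  by (simp add: letter_inv_def)

lemma letter_inv_neq [simp]: "letter_inv x \<noteq> x" "x \<noteq> letter_inv x"
  by (auto simp: letter_inv_def prod_eq_iff)

lemma reduced_Nil [simp]: "reduced []"
  by (simp add: reduced_def)

lemma reduced_Cons: "reduced (x # w) \<longleftrightarrow> reduced w \<and> (w = [] \<or> hd w \<noteq> letter_inv x)"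
  by (cases w) (auto simp: reduced_def)

lemma reduced_cons_reduce: "reduced w \<Longrightarrow> reduced (cons_reduce x w)"
  by (cases w) (auto simp: cons_reduce_def reduced_Cons)

lemma reduced_foldr: "reduced v \<Longrightarrow> reduced (foldr cons_reduce u v)"
  by (induction u) (auto simp: reduced_cons_reduce)

lemma cons_reduce_inv: "reduced w \<Longrightarrow> cons_reduce x (cons_reduce (letter_inv x) w) = w"
  by (cases w) (auto simp: cons_reduce_def reduced_Cons split: list.splits)

lemma foldr_cons_reduce_cons_reduce:
  assumes "reduced w"
  shows "foldr cons_reduce (cons_reduce x z) w = cons_reduce x (foldr cons_reduce z w)"
proof (cases z)
  case (Cons y v)
  then show ?thesis
    using cons_reduce_inv[OF reduced_foldr[OF assms, of v], of x] by (auto simp: cons_reduce_def)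
qed (simp add: cons_reduce_def)

lemma foldr_cons_reduce_assoc:
  assumes "reduced w"
  shows "foldr cons_reduce (foldr cons_reduce u v) w = foldr cons_reduce u (foldr cons_reduce v w)"
  by (induction u) (simp_all add: foldr_cons_reduce_cons_reduce[OF assms])

lemma foldr_cons_reduce_Nil: "reduced u \<Longrightarrow> foldr cons_reduce u [] = u"
  by (induction u) (auto simp: cons_reduce_def reduced_Cons split: list.splits)

lemma foldr_cons_reduce_inverse:
  assumes "reduced w"
  shows "foldr cons_reduce (rev (map letter_inv u)) (foldr cons_reduce u w) = w"
proof (induction u)
  case (Cons x u)
  have "cons_reduce (letter_inv x) (cons_reduce x (foldr cons_reduce u w)) = foldr cons_reduce u w"
    using cons_reduce_inv[OF reduced_foldr[OF assms, of u], of "letter_inv x"] by simp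
  with Cons show ?case by simp
qed (use assms in simp)

lemma group_free_group_omega: "group free_group_omega"
proof (rule groupI)
  fix u assume u: "u \<in> carrier free_group_omega"
  define v where "v = foldr cons_reduce (rev (map letter_inv u)) []"
  have "foldr cons_reduce v u = foldr cons_reduce (rev (map letter_inv u)) u"
    using foldr_cons_reduce_assoc[of u "rev (map letter_inv u)" "[]"] u
    by (simp add: v_def free_group_omega_def)
  also have "\<dots> = []"
    using foldr_cons_reduce_inverse[of "[]" u] u
    by (simp add: foldr_cons_reduce_Nil free_group_omega_def)
  finally show "\<exists>v\<in>carrier free_group_omega. v \<otimes>\<^bsub>free_group_omega\<^esub> u = \<one>\<^bsub>free_group_omega\<^esub>"
    by (intro bexI[of _ v]) (simp_all add: free_group_omega_def v_def reduced_foldr)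
qed (auto simp: free_group_omega_def reduced_foldr foldr_cons_reduce_assoc)


section \<open>Normal subgroup trees\<close>

definition finitely_generated :: "('a, 'b) monoid_scheme \<Rightarrow> bool"
  where "finitely_generated G \<longleftrightarrow>
    (\<exists>S. finite S \<and> S \<subseteq> carrier G \<and> generate G S = carrier G)"

definition max_normal :: "('a, 'b) monoid_scheme \<Rightarrow> bool"
  where "max_normal G \<longleftrightarrow>
    \<not> (\<exists>H :: nat \<Rightarrow> 'a set. \<forall>n. H n \<lhd> G \<and> H n \<subset> H (Suc n))"

definition normal_closure :: "('a, 'b) monoid_scheme \<Rightarrow> 'a set \<Rightarrow> 'a set"
  where "normal_closure G S = \<Inter>{H. H \<lhd> G \<and> S \<subseteq> H}"

inductive_set normal_subgroup_tree :: "('a, 'b) monoid_scheme \<Rightarrow> (nat \<Rightarrow> 'a) \<Rightarrow> nat list set"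
  for G :: "('a, 'b) monoid_scheme" and g :: "nat \<Rightarrow> 'a"
  where
    Nil: "[] \<in> normal_subgroup_tree G g"
  | snoc: "s \<in> normal_subgroup_tree G g \<Longrightarrow>
      normal_closure G (g ` set s \<union> {g i}) \<noteq> normal_closure G (g ` set s) \<Longrightarrow>
      s @ [i] \<in> normal_subgroup_tree G g"

lemma is_tree_normal_subgroup_tree: "is_tree (normal_subgroup_tree G g)"
proof -
  have "s \<in> normal_subgroup_tree G g"
    if "t \<in> normal_subgroup_tree G g" "prefix s t" for s t
    using that
    by (induction arbitrary: s rule: normal_subgroup_tree.induct)
       (auto simp: prefix_snoc intro: normal_subgroup_tree.intros)
  then show ?thesis unfolding is_tree_def by blast
qed

end

theory Submission
  imports Defs "HOL-Algebra.Sym_Groups"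
begin

text \<open>
  Let \<open>A\<close> be a finite nonabelian simple group and let \<open>\<int>\<close> act on a set whose points carry a label
  \<open>True\<close> or \<open>False\<close>. Call an \<open>A\<close>-valued function on this set local if its value at a point depends on
  finitely many labels along the orbit of that point. The local functions, extended by the
  translations, form a group \<open>H\<close>. It is finitely generated: the commutator of a function supported on
  a cylinder \<open>B\<close> with one supported on a cylinder \<open>C\<close> is supported on \<open>B \<inter> C\<close>, and since \<open>A\<close> is perfect,
  all functions on \<open>B \<inter> C\<close> arise in this way (\<open>wreath_finitely_generated\<close>).

  Because \<open>A\<close> is simple and nonabelian, the local functions in a normal subgroup \<open>K\<close> are exactly those
  supported on the cylinders on which \<open>K\<close> contains all functions (\<open>base_mem_iff\<close>). Hence \<open>K\<close> is
  controlled by the set of finite patterns whose cylinder is not of this kind, the patterns alive for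
  \<open>K\<close>; this set is closed under subpatterns and every pattern in it extends to longer ones in it. As
  \<open>\<int>\<close> has no infinite chain of subgroups, \<open>H\<close> has the maximal condition on normal subgroups as soon as
  such sets of patterns satisfy the descending chain condition. So the problem becomes one
  about sequences of zeros and ones indexed by \<open>\<int>\<close>: it suffices to find sequences for which these sets of patterns
  are well-ordered by inclusion, with order type at least \<open>\<alpha>\<close>.

  Such sequences \<open>x\<^sub>\<kappa>\<close>, for \<open>\<kappa> \<le> \<alpha>\<close>, are built from blocks of growing levels. Enumerate the ordinals up
  to \<open>\<alpha>\<close> as \<open>e 0 = \<alpha>, e 1, \<dots>\<close>. The points \<open>e 0, \<dots>, e n\<close> cut the ordinals up to \<open>\<alpha>\<close> into finitely many
  intervals, and there is one block of level \<open>n\<close> for each interval. A block of level \<open>n + 1\<close> contains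
  all blocks of level \<open>n\<close> that belong to the same or a lower interval and no others. All blocks are
  separated by long gaps, so that a short pattern meets only one block, and blocks can be recognised
  inside a sequence. Consequently a set of patterns as above is determined by the blocks in it, and these
  in turn by a single ordinal \<open>\<mu>\<close>: they are the blocks whose interval is not above that of \<open>\<mu>\<close>
  (\<open>alive_iff_below_height\<close>; the case that no block of some level is alive is treated separately). Enlarging the
  normal subgroup can only decrease \<open>\<mu>\<close>, so well-foundedness of the ordinals
  yields the maximal condition (\<open>max_normal_wreath\<close>).

  For the rank, the local functions that vanish on the orbits of all \<open>x\<^sub>\<kappa>\<close> with \<open>\<kappa> \<le> \<beta>\<close> form a
  normal subgroup that shrinks strictly as \<open>\<beta>\<close> increases to \<open>\<alpha>\<close> (\<open>vanishing_strict\<close>), and a strictly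
  decreasing family of normal subgroups indexed by the ordinals up to \<open>\<alpha>\<close> forces rank at least \<open>\<alpha>\<close>
  (\<open>le_node_rank\<close>).
\<close>

section \<open>Rank from chains of normal subgroups\<close>

lemma (in group) normal_Inter:
  assumes "\<N> \<noteq> {}" "\<And>N. N \<in> \<N> \<Longrightarrow> N \<lhd> G"
  shows "\<Inter>\<N> \<lhd> G"
  unfolding normal_inv_iff
  using assms subgroups_Inter[of \<N>] normal_imp_subgroup normal.inv_op_closed2
  by (smt (verit) Inter_iff normal_inv_iff)

lemma (in group) normal_closure_normal:
  assumes "S \<subseteq> carrier G"
  shows "normal_closure G S \<lhd> G"
proof -
  have "carrier G \<lhd> G" by (simp add: normal_inv_iff subgroup_self)
  then show ?thesis
    unfolding normal_closure_def using assms by (intro normal_Inter) auto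
qed

lemma normal_closure_incl: "S \<subseteq> normal_closure G S"
  by (auto simp: normal_closure_def)

lemma normal_closure_least: "N \<lhd> G \<Longrightarrow> S \<subseteq> N \<Longrightarrow> normal_closure G S \<subseteq> N"
  by (auto simp: normal_closure_def)

lemma normal_closure_mono: "S \<subseteq> S' \<Longrightarrow> normal_closure G S \<subseteq> normal_closure G S'"
  by (auto simp: normal_closure_def)

text \<open>
  Along an infinite branch the normal closures of the initial segments would increase strictly for ever.
\<close>

lemma (in group) max_normal_imp_well_founded_tree:
  assumes "max_normal G" and "range g \<subseteq> carrier G"
  shows "well_founded_tree (normal_subgroup_tree G g)"
  unfolding well_founded_tree_def
proof
  assume "\<exists>x. \<forall>n. map x [0..<n] \<in> normal_subgroup_tree G g"
  then obtain x where x: "map x [0..<n] \<in> normal_subgroup_tree G g" for n by blast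
  define H where "H n = normal_closure G (g ` set (map x [0..<n]))" for n
  have "H n \<lhd> G" for n
    unfolding H_def using assms(2) by (intro normal_closure_normal) auto
  moreover have "H n \<subset> H (Suc n)" for n
  proof -
    have "map x [0..<n] @ [x n] \<in> normal_subgroup_tree G g"
      using x[of "Suc n"] by simp
    then have "normal_closure G (g ` set (map x [0..<n]) \<union> {g (x n)}) \<noteq> H n"
      by (cases rule: normal_subgroup_tree.cases) (auto simp: H_def)
    moreover have "g ` set (map x [0..<n]) \<union> {g (x n)} = g ` set (map x [0..<Suc n])" by auto
    moreover have "H n \<subseteq> H (Suc n)"
      unfolding H_def by (rule normal_closure_mono) auto
    ultimately show ?thesis by (auto simp: H_def)
  qed
  ultimately show False using assms(1) unfolding max_normal_def by blast
qed

text \<open>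
  By induction on \<open>\<beta>\<close>: if the rank of \<open>s\<close> were a smaller ordinal \<open>\<beta>'\<close>, an element of \<open>N \<beta>'\<close> outside \<open>N \<beta>\<close>
  would extend \<open>s\<close> to a node of the tree that still lies in \<open>N \<beta>'\<close>. By induction this node has rank at
  least \<open>\<beta>'\<close>, so \<open>s\<close> would have rank greater than \<open>\<beta>'\<close>.
\<close>

lemma (in group) le_node_rank:
  fixes N :: "ordinal \<Rightarrow> 'a set"
  assumes wf: "well_founded_tree (normal_subgroup_tree G g)" and g: "range g = carrier G"
    and N: "\<And>\<beta>. \<beta> \<le> \<alpha> \<Longrightarrow> N \<beta> \<lhd> G"
    and strict: "\<And>\<beta> \<beta>'. \<beta> < \<beta>' \<Longrightarrow> \<beta>' \<le> \<alpha> \<Longrightarrow> N \<beta>' \<subset> N \<beta>"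
  shows "\<beta> \<le> \<alpha> \<Longrightarrow> s \<in> normal_subgroup_tree G g \<Longrightarrow> g ` set s \<subseteq> N \<beta> \<Longrightarrow>
    \<beta> \<le> node_rank (normal_subgroup_tree G g) s"
proof (induction \<beta> arbitrary: s rule: less_induct)
  case (less \<beta>)
  define T where "T = normal_subgroup_tree G g"
  show ?case
  proof (rule ccontr)
    assume "\<not> ?case"
    then have lt: "node_rank T s < \<beta>" by (simp add: T_def)
    then obtain x where x: "x \<in> N (node_rank T s)" "x \<notin> N \<beta>"
      using strict less.prems(1) by blast
    have le: "node_rank T s \<le> \<alpha>" using lt less.prems(1) by simp
    obtain i where i: "x = g i"
      using x(1) N[OF le] g normal_imp_subgroup subgroup.subset by blast
    let ?t = "s @ [i]"
    have "g i \<in> normal_closure G (g ` set s \<union> {g i})"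
      using normal_closure_incl[of "g ` set s \<union> {g i}"] by blast
    moreover have "g i \<notin> normal_closure G (g ` set s)"
      using normal_closure_least[OF N[OF less.prems(1)] less.prems(3)] x(2) i by blast
    ultimately have t: "?t \<in> T"
      unfolding T_def using less.prems(2) by (intro normal_subgroup_tree.snoc) auto
    have "g ` set ?t \<subseteq> N (node_rank T s)"
      using less.prems strict[OF lt] x(1) i by auto
    then have "node_rank T s \<le> node_rank T ?t"
      using less.IH[OF lt le] t unfolding T_def by blast
    also have "\<dots> < node_rank T s"
    proof -
      have "strict_prefix s ?t" by (simp add: strict_prefix_def)
      then have "osucc (node_rank T ?t) \<le> (SUP s\<in>{t\<in>T. strict_prefix s t}. osucc (node_rank T s))"
        using t by (intro cSUP_upper bdd_above_node_rank) auto
      also have "\<dots> = node_rank T s"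
        using node_rank_eq[OF is_tree_normal_subgroup_tree wf, of s] by (simp add: T_def)
      finally show ?thesis by (simp add: osucc_le_iff)
    qed
    finally show False by simp
  qed
qed

section \<open>Finitely generated groups as quotients of the free group\<close>

definition letter_value :: "('a, 'b) monoid_scheme \<Rightarrow> (nat \<Rightarrow> 'a) \<Rightarrow> letter \<Rightarrow> 'a"
  where "letter_value G h x = (if snd x then h (fst x) else inv\<^bsub>G\<^esub> h (fst x))"

definition word_value :: "('a, 'b) monoid_scheme \<Rightarrow> (nat \<Rightarrow> 'a) \<Rightarrow> letter list \<Rightarrow> 'a"
  where "word_value G h w = foldr (\<lambda>x a. letter_value G h x \<otimes>\<^bsub>G\<^esub> a) w \<one>\<^bsub>G\<^esub>"

context group
begin

context
  fixes h :: "nat \<Rightarrow> 'a"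
  assumes h: "\<And>n. h n \<in> carrier G"
begin

lemma letter_value_closed [simp]: "letter_value G h x \<in> carrier G"
  by (simp add: letter_value_def h)

lemma word_value_closed [simp]: "word_value G h w \<in> carrier G"
  by (induction w) (simp_all add: word_value_def)

lemma letter_value_inv: "letter_value G h (letter_inv x) = inv (letter_value G h x)"
  by (simp add: letter_value_def letter_inv_def h)

lemma word_value_Cons: "word_value G h (x # w) = letter_value G h x \<otimes> word_value G h w"
  by (simp add: word_value_def)

text \<open>Cancelling a letter against its inverse does not change the value, which makes evaluation a
  homomorphism on reduced words.\<close>

lemma word_value_cons_reduce:
  "word_value G h (cons_reduce x w) = letter_value G h x \<otimes> word_value G h w"
  by (cases w) (auto simp: cons_reduce_def word_value_Cons letter_value_inv simp flip: m_assoc)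

lemma word_value_foldr:
  "word_value G h (foldr cons_reduce u v) = word_value G h u \<otimes> word_value G h v"
  by (induction u) (simp_all add: word_value_cons_reduce word_value_Cons m_assoc,
      simp add: word_value_def)

lemma word_value_hom: "group_hom free_group_omega G (word_value G h)"
proof (intro group_hom.intro group_hom_axioms.intro group_free_group_omega)
  show "word_value G h \<in> hom free_group_omega G"
    by (auto simp: hom_def free_group_omega_def word_value_foldr)
qed unfold_locales

lemma word_value_generator: "word_value G h [(n, True)] = h n"
  using h by (simp add: word_value_def letter_value_def)

end

lemma finitely_generated_imp_quotient_free_group:
  assumes "finitely_generated G"
  shows "\<exists>\<phi>. group_hom free_group_omega G \<phi> \<and> \<phi> ` carrier free_group_omega = carrier G"
proof -
  obtain S where S: "finite S" "S \<subseteq> carrier G" "generate G S = carrier G"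
    using assms unfolding finitely_generated_def by blast
  obtain gs where gs: "set gs = S" using S(1) finite_list by blast
  define h where "h n = (if n < length gs then gs ! n else \<one>)" for n
  have h: "h n \<in> carrier G" for n
    using gs S(2) nth_mem[of n gs] by (auto simp: h_def simp del: nth_mem)
  interpret \<phi>: group_hom free_group_omega G "word_value G h" by (rule word_value_hom[OF h])
  have "S \<subseteq> word_value G h ` carrier free_group_omega"
  proof
    fix s assume "s \<in> S"
    then obtain n where "n < length gs" "s = gs ! n" using gs by (metis in_set_conv_nth)
    then have "s = word_value G h [(n, True)]"
      by (simp add: word_value_generator[OF h] h_def)
    then show "s \<in> word_value G h ` carrier free_group_omega"
      by (auto simp: free_group_omega_def reduced_Cons)
  qed
  then have "carrier G \<subseteq> word_value G h ` carrier free_group_omega"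
    using generate_subgroup_incl \<phi>.img_is_subgroup S(3) by blast
  then show ?thesis using \<phi>.group_hom_axioms \<phi>.hom_closed by blast
qed

end

lemma finitely_generated_iso:
  assumes "\<theta> \<in> iso H G" "group H" "group G" "finitely_generated H"
  shows "finitely_generated G"
proof -
  interpret \<theta>: group_hom H G \<theta>
    using assms by (simp add: group_hom_def group_hom_axioms_def iso_imp_homomorphism)
  obtain S where "finite S" "S \<subseteq> carrier H" "generate H S = carrier H"
    using assms(4) unfolding finitely_generated_def by blast
  moreover from this have "generate G (\<theta> ` S) = carrier G"
    using \<theta>.generate_img[of S] assms(1) by (simp add: iso_iff)
  ultimately show ?thesis
    unfolding finitely_generated_def using \<theta>.hom_closed by (intro exI[of _ "\<theta> ` S"]) auto
qed

lemma strict_image_iso: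
  assumes "\<theta> \<in> iso H G" "M \<subset> N" "N \<subseteq> carrier H"
  shows "\<theta> ` M \<subset> \<theta> ` N"
proof -
  have "inj_on \<theta> (carrier H)" using assms(1) by (simp add: iso_iff)
  then show ?thesis using assms(2,3)
    by (metis inj_on_image_eq_iff image_mono psubset_eq order_trans)
qed

lemma max_normal_iso:
  assumes "\<theta> \<in> iso H G" "group H" "group G" "max_normal H"
  shows "max_normal G"
  unfolding max_normal_def
proof
  assume "\<exists>K. \<forall>n. K n \<lhd> G \<and> K n \<subset> K (Suc n)"
  then obtain K where K: "\<And>n. K n \<lhd> G" "\<And>n. K n \<subset> K (Suc n)" by blast
  have i: "inv_into (carrier H) \<theta> \<in> iso G H"
    using assms by (simp add: group.iso_set_sym)
  define L where "L n = inv_into (carrier H) \<theta> ` K n" for n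
  have "L n \<lhd> H" for n
    unfolding L_def using iso_normal_subgroup[OF i assms(3,2) K(1)] .
  moreover have "L n \<subset> L (Suc n)" for n
    unfolding L_def
    by (rule strict_image_iso[OF i K(2) subgroup.subset[OF normal_imp_subgroup[OF K(1)]]])
  ultimately show False
    using assms(4) unfolding max_normal_def by blast
qed

text \<open>
  A marked group is a quotient of the free group, so properties of an abstract finitely generated group are
  transported along the isomorphism of that group with a quotient.
\<close>

lemma (in group) marked_quotient_of_large_rank:
  fixes \<gamma> :: "nat \<Rightarrow> letter list" and N :: "ordinal \<Rightarrow> 'a set"
  assumes \<gamma>: "range \<gamma> = carrier free_group_omega"
    and fg: "finitely_generated G" and max: "max_normal G"
    and N: "\<And>\<beta>. \<beta> \<le> \<alpha> \<Longrightarrow> N \<beta> \<lhd> G"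
    and strict: "\<And>\<beta> \<beta>'. \<beta> < \<beta>' \<Longrightarrow> \<beta>' \<le> \<alpha> \<Longrightarrow> N \<beta>' \<subset> N \<beta>"
  shows "\<exists>M. M \<lhd> free_group_omega \<and>
    (let Q = free_group_omega Mod M; g = (\<lambda>i. M #>\<^bsub>free_group_omega\<^esub> \<gamma> i) in
      finitely_generated Q \<and> max_normal Q \<and> \<alpha> \<le> tree_rank (normal_subgroup_tree Q g))"
proof -
  let ?F = free_group_omega
  obtain \<phi> where \<phi>: "group_hom ?F G \<phi>" and surj: "\<phi> ` carrier ?F = carrier G"
    using finitely_generated_imp_quotient_free_group[OF fg] by blast
  interpret \<phi>: group_hom ?F G \<phi> by (rule \<phi>)
  define M where "M = kernel ?F G \<phi>"
  have M: "M \<lhd> ?F" unfolding M_def by (rule \<phi>.normal_kernel)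
  interpret M: normal M ?F by (rule M)
  define Q where "Q = ?F Mod M"
  define g where "g i = M #>\<^bsub>?F\<^esub> \<gamma> i" for i
  interpret Q: group Q unfolding Q_def by (rule M.factorgroup_is_group)
  have g: "range g = carrier Q"
    using \<gamma> by (auto simp: g_def Q_def FactGroup_def RCOSETS_def image_iff) (metis rangeE)
  have "(\<lambda>X. the_elem (\<phi> ` X)) \<in> iso Q G"
    unfolding Q_def M_def by (rule \<phi>.FactGroup_iso_set[OF surj])
  then obtain \<theta> where \<theta>: "\<theta> \<in> iso G Q"
    using Q.iso_set_sym by blast
  have mQ: "max_normal Q" using max_normal_iso[OF \<theta> is_group Q.is_group max] .
  let ?T = "normal_subgroup_tree Q g"
  have wf: "well_founded_tree ?T"
    using Q.max_normal_imp_well_founded_tree[OF mQ] g by simp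
  have "\<alpha> \<le> node_rank ?T []"
  proof (rule Q.le_node_rank[OF wf g, where N = "\<lambda>\<beta>. \<theta> ` N \<beta>" and \<alpha> = \<alpha>])
    show "\<theta> ` N \<beta> \<lhd> Q" if "\<beta> \<le> \<alpha>" for \<beta>
      using iso_normal_subgroup[OF \<theta> is_group Q.is_group N[OF that]] .
    show "\<theta> ` N \<beta>' \<subset> \<theta> ` N \<beta>" if "\<beta> < \<beta>'" "\<beta>' \<le> \<alpha>" for \<beta> \<beta>'
      using strict_image_iso[OF \<theta> strict[OF that]] N[of \<beta>] that
      by (simp add: normal_imp_subgroup subgroup.subset)
  qed (auto intro: normal_subgroup_tree.Nil)
  also have "\<dots> \<le> tree_rank ?T"
    using wf less_osucc[of "node_rank ?T []"] normal_subgroup_tree.Nil[of Q g]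
    by (auto simp: tree_rank_def)
  finally have "finitely_generated Q \<and> max_normal Q \<and> \<alpha> \<le> tree_rank ?T"
    using finitely_generated_iso[OF \<theta> is_group Q.is_group fg] mQ by blast
  then show ?thesis
    using M by (auto simp: Let_def Q_def g_def[abs_def])
qed

section \<open>A finite nonabelian simple group\<close>

lemma (in group_hom) subgroup_vimage:
  assumes "subgroup N H"
  shows "subgroup {x \<in> carrier G. h x \<in> N} G"
  by unfold_locales (use subgroup.m_closed[OF assms] subgroup.one_closed[OF assms]
    subgroup.m_inv_closed[OF assms] in auto)

lemma (in group_hom) normal_vimage:
  assumes "N \<lhd> H"
  shows "{x \<in> carrier G. h x \<in> N} \<lhd> G"
  unfolding G.normal_inv_iff
  using subgroup_vimage normal_imp_subgroup[OF assms] normal.inv_op_closed2[OF assms] by auto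

locale finite_perfect_simple_group = group A for A (structure) +
  assumes finite_carrier: "finite (carrier A)"
    and perfect: "derived A (carrier A) = carrier A"
    and nontrivial: "carrier A \<noteq> {\<one>}"
    and simple: "N \<lhd> A \<Longrightarrow> N = {\<one>} \<or> N = carrier A"

text \<open>
  Otherwise the centre is a nontrivial normal subgroup, hence everything, and the group would be abelian
  as well as perfect.
\<close>

lemma (in finite_perfect_simple_group) ex_noncommuting:
  assumes a: "a \<in> carrier A" "a \<noteq> \<one>"
  shows "\<exists>b\<in>carrier A. a \<otimes> b \<otimes> inv a \<otimes> inv b \<noteq> \<one>"
proof (rule ccontr)
  assume contra: "\<not> ?thesis"
  define Z where "Z = {z \<in> carrier A. \<forall>b\<in>carrier A. z \<otimes> b = b \<otimes> z}"
  have "a \<in> Z"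
    unfolding Z_def
  proof (clarsimp simp: a)
    fix b assume b: "b \<in> carrier A"
    then have "a \<otimes> b \<otimes> inv a \<otimes> inv b = \<one>" using contra by blast
    moreover have "a \<otimes> b \<otimes> inv (b \<otimes> a) = a \<otimes> b \<otimes> inv a \<otimes> inv b"
      using a(1) b by (simp add: inv_mult_group m_assoc)
    ultimately have "a \<otimes> b = \<one> \<otimes> (b \<otimes> a)"
      using a b by (intro iffD1[OF inv_solve_right[of \<one> "a \<otimes> b" "b \<otimes> a"]]) simp_all
    also have "\<dots> = b \<otimes> a" using a b by (intro l_one m_closed)
    finally show "a \<otimes> b = b \<otimes> a" .
  qed
  have sub: "subgroup Z A"
  proof
    fix x y assume x: "x \<in> Z" and y: "y \<in> Z"
    show "x \<otimes> y \<in> Z"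
      unfolding Z_def
    proof (clarsimp, intro conjI ballI)
      show "x \<otimes> y \<in> carrier A" using x y unfolding Z_def by blast
      fix b assume b: "b \<in> carrier A"
      have c: "x \<in> carrier A" "y \<in> carrier A" "y \<otimes> b = b \<otimes> y" "x \<otimes> b = b \<otimes> x"
        using x y b by (auto simp: Z_def)
      have "x \<otimes> y \<otimes> b = x \<otimes> (y \<otimes> b)" using c(1,2) b by (simp add: m_assoc)
      also have "\<dots> = x \<otimes> b \<otimes> y" using c(1,2) b by (simp add: c(3) m_assoc)
      also have "\<dots> = b \<otimes> (x \<otimes> y)" using c(1,2) b by (simp add: c(4) m_assoc)
      finally show "x \<otimes> y \<otimes> b = b \<otimes> (x \<otimes> y)" .
    qed
  next
    fix x assume x: "x \<in> Z"
    then have xc: "x \<in> carrier A" by (auto simp: Z_def)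
    show "inv x \<in> Z"
      unfolding Z_def
    proof (clarsimp simp: xc)
      fix b assume b: "b \<in> carrier A"
      then have comm: "x \<otimes> b = b \<otimes> x" using x unfolding Z_def by blast
      have "inv x \<otimes> b = inv x \<otimes> (b \<otimes> x) \<otimes> inv x" using xc b by (simp add: m_assoc)
      also have "\<dots> = inv x \<otimes> (x \<otimes> b) \<otimes> inv x" by (simp only: comm)
      also have "\<dots> = b \<otimes> inv x" using xc b by (simp flip: m_assoc)
      finally show "inv x \<otimes> b = b \<otimes> inv x" .
    qed
  qed (auto simp: Z_def)
  have "Z \<lhd> A"
    unfolding normal_inv_iff
  proof (intro conjI sub ballI)
    fix x h assume x: "x \<in> carrier A" and h: "h \<in> Z"
    have hc: "h \<in> carrier A" using h unfolding Z_def by blast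
    have "h \<otimes> x = x \<otimes> h" using x h unfolding Z_def by blast
    then have "x \<otimes> h \<otimes> inv x = h" using x hc by (metis inv_solve_right m_closed)
    then show "x \<otimes> h \<otimes> inv x \<in> Z" using h by simp
  qed
  with \<open>a \<in> Z\<close> a(2) have Z: "Z = carrier A" using simple by blast
  have "derived A (carrier A) \<subseteq> {\<one>}"
    unfolding derived_def
  proof (rule generate_subgroup_incl)
    show "derived_set A (carrier A) \<subseteq> {\<one>}"
    proof clarsimp
      fix x y assume xy: "x \<in> carrier A" "y \<in> carrier A"
      then have "x \<otimes> y = y \<otimes> x" using Z unfolding Z_def by blast
      then show "x \<otimes> y \<otimes> inv x \<otimes> inv y = \<one>"
        using xy r_inv[of "y \<otimes> x"] by (simp add: m_assoc inv_mult_group)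
    qed
  qed (rule triv_subgroup)
  then show False using perfect nontrivial by auto
qed

text \<open>
  Rather than proving that the alternating group on five letters is simple, one divides it by a
  maximal proper normal subgroup: the quotient is simple, and it is still perfect and nontrivial.
\<close>

lemma ex_finite_perfect_simple_group:
  "\<exists>A :: (nat \<Rightarrow> nat) set monoid. finite_perfect_simple_group A"
proof -
  define G where "G = alt_group 5"
  interpret G: group G unfolding G_def by (rule alt_group_is_group)
  have fin: "finite (carrier G)"
  proof (rule finite_subset)
    show "carrier G \<subseteq> {p. p permutes {1..5}}" by (auto simp: G_def alt_group_carrier)
    show "finite {p. p permutes {1..5::nat}}" by (simp add: finite_permutations)
  qed
  have perf: "derived G (carrier G) = carrier G"
    unfolding G_def by (rule derived_alt_group_const) simp
  have "2 * card (carrier G) = fact 5"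
    unfolding G_def by (rule alt_group_card_carrier) simp
  then have nontriv: "carrier G \<noteq> {\<one>\<^bsub>G\<^esub>}" by (auto simp: fact_numeral)
  define \<N> where "\<N> = {N. N \<lhd> G \<and> N \<noteq> carrier G}"
  have "\<N> \<subseteq> Pow (carrier G)" by (auto simp: \<N>_def normal_def dest: subgroup.subset)
  then have "finite \<N>" using fin finite_subset by blast
  moreover have "{\<one>\<^bsub>G\<^esub>} \<in> \<N>" using nontriv G.one_is_normal by (auto simp: \<N>_def)
  ultimately have "\<exists>M\<in>\<N>. \<forall>N\<in>\<N>. M \<subseteq> N \<longrightarrow> M = N"
    by (intro finite_has_maximal) auto
  then obtain M where M: "M \<in> \<N>" and max: "\<And>N. N \<in> \<N> \<Longrightarrow> M \<subseteq> N \<Longrightarrow> M = N"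
    by (elim bexE) simp
  have MG: "M \<lhd> G" "M \<noteq> carrier G" using M by (auto simp: \<N>_def)
  interpret M: normal M G by (rule MG)
  define A where "A = G Mod M"
  interpret A: group A unfolding A_def by (rule M.factorgroup_is_group)
  define q where "q x = M #>\<^bsub>G\<^esub> x" for x
  have q: "q \<in> hom G A" unfolding q_def A_def by (rule M.r_coset_hom_Mod)
  interpret q: group_hom G A q by unfold_locales (rule q)
  have surj: "q ` carrier G = carrier A"
    by (auto simp: q_def A_def FactGroup_def RCOSETS_def)
  have q_one: "q x = \<one>\<^bsub>A\<^esub> \<longleftrightarrow> x \<in> M" if "x \<in> carrier G" for x
    using that G.coset_join1[of M x] M.rcos_const[of x] M.is_subgroup
    unfolding q_def A_def FactGroup_def by auto
  have "finite_perfect_simple_group A"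
  proof
    show "finite (carrier A)" using fin surj by (metis finite_imageI)
    show "derived A (carrier A) = carrier A"
      using q.derived_img[of "carrier G"] perf surj by simp
    show "carrier A \<noteq> {\<one>\<^bsub>A\<^esub>}"
    proof
      assume "carrier A = {\<one>\<^bsub>A\<^esub>}"
      then have "x \<in> M" if "x \<in> carrier G" for x
        using q_one[OF that] q.hom_closed[OF that] by simp
      then have "carrier G \<subseteq> M" by (rule subsetI)
      then show False using MG(2) M.subset subset_antisym by metis
    qed
    fix N assume N: "N \<lhd> A"
    define P where "P = {x \<in> carrier G. q x \<in> N}"
    have "P \<lhd> G"
      unfolding P_def by (rule q.normal_vimage[OF N])
    have "M \<subseteq> P"
    proof
      fix x assume x: "x \<in> M"
      then have xG: "x \<in> carrier G" using M.subset by (simp add: subset_iff)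
      have "\<one>\<^bsub>A\<^esub> \<in> N" by (rule subgroup.one_closed[OF normal_imp_subgroup[OF N]])
      then show "x \<in> P" using q_one[OF xG] x xG by (simp add: P_def)
    qed
    then have "P = M \<or> P = carrier G"
      using max[of P] \<open>P \<lhd> G\<close> unfolding \<N>_def by blast
    moreover have "N = q ` P"
    proof
      show "q ` P \<subseteq> N" by (auto simp: P_def)
      show "N \<subseteq> q ` P"
      proof
        fix y assume y: "y \<in> N"
        then have "y \<in> q ` carrier G"
          unfolding surj by (rule subgroup.mem_carrier[OF normal_imp_subgroup[OF N]])
        then show "y \<in> q ` P" using y by (auto simp: P_def)
      qed
    qed
    moreover have "q ` M = {\<one>\<^bsub>A\<^esub>}"
    proof -
      have "q x = \<one>\<^bsub>A\<^esub>" if "x \<in> M" for x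
        using q_one[of x] that M.subset by blast
      then have "q ` M \<subseteq> {\<one>\<^bsub>A\<^esub>}" by blast
      moreover have "q \<one>\<^bsub>G\<^esub> \<in> q ` M" by (rule imageI[OF M.one_closed])
      ultimately show ?thesis by blast
    qed
    ultimately show "N = {\<one>\<^bsub>A\<^esub>} \<or> N = carrier A"
      using surj by auto
  qed
  then show ?thesis by blast
qed

section \<open>Groups of locally constant functions extended by a shift\<close>

text \<open>
  The least positive integer in the union of the chain generates that union, and it occurs at some stage.
\<close>

lemma int_subgroup_chain_stabilises:
  fixes S :: "nat \<Rightarrow> int set"
  assumes mono: "\<And>n. S n \<subseteq> S (Suc n)"
    and diff: "\<And>n j k. j \<in> S n \<Longrightarrow> k \<in> S n \<Longrightarrow> j - k \<in> S n"
  shows "\<exists>m. \<forall>n\<ge>m. S n \<subseteq> S m"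
proof -
  have chain: "S m \<subseteq> S n" if "m \<le> n" for m n
    using that by (rule lift_Suc_mono_le[of S, OF mono])
  have zero: "0 \<in> S n" if "k \<in> S n" for k n using diff[OF that that] by simp
  have minus: "- k \<in> S n" if "k \<in> S n" for k n using diff[OF zero[OF that] that] by simp
  have mult: "q * k \<in> S n" if "k \<in> S n" for q k n
  proof (induction q rule: int_induct[where k = 0])
    case base
    then show ?case using zero[OF that] by simp
  next
    case (step1 i)
    then show ?case using diff[OF step1(2) minus[OF that]] by (simp add: algebra_simps)
  next
    case (step2 i)
    then show ?case using diff[OF step2(2) that] by (simp add: algebra_simps)
  qed
  show ?thesis
  proof (cases "\<exists>d::nat. 0 < d \<and> (\<exists>n. int d \<in> S n)")
    case False
    have "S n \<subseteq> S (LEAST n. S n \<noteq> {})" for n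
    proof
      fix k assume k: "k \<in> S n"
      have "k = 0"
      proof (rule ccontr)
        assume "k \<noteq> 0"
        then have "0 < nat \<bar>k\<bar>" "int (nat \<bar>k\<bar>) \<in> S n" using k minus[OF k] by (auto simp: abs_if)
        then show False using False by blast
      qed
      moreover have "S (LEAST n. S n \<noteq> {}) \<noteq> {}" using k by (intro LeastI[of "\<lambda>n. S n \<noteq> {}" n]) auto
      ultimately show "k \<in> S (LEAST n. S n \<noteq> {})" using zero by blast
    qed
    then show ?thesis by blast
  next
    case True
    define d where "d = (LEAST d::nat. 0 < d \<and> (\<exists>n. int d \<in> S n))"
    have d: "0 < d" "\<exists>n. int d \<in> S n" using LeastI_ex[OF True] by (auto simp: d_def)
    have least: "d \<le> c" if "0 < c" "int c \<in> S n" for c n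
      unfolding d_def using that by (intro Least_le) auto
    obtain m where m: "int d \<in> S m" using d(2) by blast
    have "S n \<subseteq> S m" if "m \<le> n" for n
    proof
      fix k assume k: "k \<in> S n"
      have dn: "int d \<in> S n" using m chain[OF that] by blast
      have "k - k div int d * int d \<in> S n" using diff[OF k mult[OF dn]] .
      then have "k mod int d \<in> S n" by (simp add: minus_div_mult_eq_mod)
      have "k mod int d = 0"
      proof (rule ccontr)
        assume "k mod int d \<noteq> 0"
        moreover have "0 \<le> k mod int d" "k mod int d < int d" using d(1) by simp_all
        ultimately have "d \<le> nat (k mod int d)"
          using \<open>k mod int d \<in> S n\<close> by (intro least[where n = n]) simp_all
        then show False using \<open>k mod int d < int d\<close> d(1) by linarith
      qed
      then show "k \<in> S m" using mult[OF m, of "k div int d"] by (metis add.right_neutral div_mult_mod_eq)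
    qed
    then show ?thesis by blast
  qed
qed

locale labelled_shift =
  fixes T :: "int \<Rightarrow> 'w \<Rightarrow> 'w" and lab :: "'w \<Rightarrow> bool"
  assumes T_0 [simp]: "T 0 w = w" and T_T [simp]: "T j (T k w) = T (j + k) w"
begin

text \<open>A finite pattern of labels is represented by the set of points that show it, here the pattern that
  the point \<open>w\<close> shows on the positions \<open>D\<close>.\<close>

definition cyl :: "int set \<Rightarrow> 'w \<Rightarrow> 'w set"
  where "cyl D w = {v. \<forall>d\<in>D. lab (T d v) = lab (T d w)}"

lemma in_cyl_self [simp]: "w \<in> cyl D w"
  by (simp add: cyl_def)

lemma cyl_eq: "v \<in> cyl D w \<Longrightarrow> cyl D v = cyl D w"
  by (auto simp: cyl_def)

lemma cyl_sym: "v \<in> cyl D w \<Longrightarrow> w \<in> cyl D v"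
  by (auto simp: cyl_def)

lemma cyl_antimono: "D \<subseteq> D' \<Longrightarrow> cyl D' w \<subseteq> cyl D w"
  by (auto simp: cyl_def)

lemma cyl_shift: "v \<in> cyl ((\<lambda>d. d + k) ` D) w \<longleftrightarrow> T k v \<in> cyl D (T k w)"
  by (auto simp: cyl_def)

lemma finite_cyls:
  assumes "finite D"
  shows "finite (range (cyl D))"
proof -
  have "range (cyl D) \<subseteq> (\<lambda>E. {v. {d \<in> D. lab (T d v)} = E}) ` Pow D"
  proof clarify
    fix w
    have "cyl D w = {v. {d \<in> D. lab (T d v)} = {d \<in> D. lab (T d w)}}"
      unfolding cyl_def by blast
    then show "cyl D w \<in> (\<lambda>E. {v. {d \<in> D. lab (T d v)} = E}) ` Pow D"
      by (rule image_eqI) auto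
  qed
  then show ?thesis by (rule finite_subset) (simp add: assms)
qed

end

locale local_wreath = finite_perfect_simple_group A + labelled_shift T lab
  for A :: "('a, 'b) monoid_scheme" (structure) and T :: "int \<Rightarrow> 'w \<Rightarrow> 'w" and lab
begin

definition local_on :: "int set \<Rightarrow> ('w \<Rightarrow> 'a) \<Rightarrow> bool"
  where "local_on D f \<longleftrightarrow> (\<forall>w. f w \<in> carrier A) \<and> (\<forall>w. \<forall>v\<in>cyl D w. f v = f w)"

text \<open>The semidirect product of the local functions with \<open>\<int>\<close>.\<close>

definition wreath :: "(('w \<Rightarrow> 'a) \<times> int) monoid"
  where "wreath =
    \<lparr>carrier = {(f, k). \<exists>D. finite D \<and> local_on D f},
     monoid.mult = (\<lambda>(f, k) (g, l). (\<lambda>w. f w \<otimes> g (T k w), k + l)),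
     one = (\<lambda>_. \<one>, 0)\<rparr>"

definition bump :: "'w set \<Rightarrow> 'a \<Rightarrow> 'w \<Rightarrow> 'a"
  where "bump B a w = (if w \<in> B then a else \<one>)"

lemma local_on_mono: "local_on D f \<Longrightarrow> D \<subseteq> D' \<Longrightarrow> local_on D' f"
  using cyl_antimono unfolding local_on_def by blast

lemma local_on_closed: "local_on D f \<Longrightarrow> f w \<in> carrier A"
  by (simp add: local_on_def)

lemma local_on_const: "a \<in> carrier A \<Longrightarrow> local_on D (\<lambda>_. a)"
  by (simp add: local_on_def)

lemma local_on_mult:
  assumes "local_on D f" "local_on E g"
  shows "local_on (D \<union> E) (\<lambda>w. f w \<otimes> g w)"
  using local_on_mono[OF assms(1), of "D \<union> E"] local_on_mono[OF assms(2), of "D \<union> E"]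
  by (simp add: local_on_def)

lemma local_on_inv: "local_on D f \<Longrightarrow> local_on D (\<lambda>w. inv (f w))"
  by (simp add: local_on_def)

lemma local_on_shift: "local_on D f \<Longrightarrow> local_on ((\<lambda>d. d + k) ` D) (\<lambda>w. f (T k w))"
  unfolding local_on_def using cyl_shift by blast

lemma local_on_bump:
  assumes "a \<in> carrier A" shows "local_on D (bump (cyl D w) a)"
  using assms cyl_eq cyl_sym unfolding local_on_def bump_def
  by (metis in_cyl_self one_closed)

lemma wreath_mult [simp]: "(f, k) \<otimes>\<^bsub>wreath\<^esub> (g, l) = (\<lambda>w. f w \<otimes> g (T k w), k + l)"
  by (simp add: wreath_def)

lemma wreath_one: "\<one>\<^bsub>wreath\<^esub> = (\<lambda>_. \<one>, 0)"
  by (simp add: wreath_def)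

lemma wreath_carrierI: "finite D \<Longrightarrow> local_on D f \<Longrightarrow> (f, k) \<in> carrier wreath"
  by (auto simp: wreath_def)

lemma wreath_carrierE:
  assumes "(f, k) \<in> carrier wreath"
  obtains D where "finite D" "local_on D f"
  using assms by (auto simp: wreath_def)

lemma wreath_mult_closed:
  assumes "x \<in> carrier wreath" "y \<in> carrier wreath"
  shows "x \<otimes>\<^bsub>wreath\<^esub> y \<in> carrier wreath"
proof -
  obtain f k g l where xy: "x = (f, k)" "y = (g, l)" by (cases x, cases y)
  obtain D where D: "finite D" "local_on D f" using assms xy wreath_carrierE by blast
  obtain E where E: "finite E" "local_on E g" using assms xy wreath_carrierE by blast
  show ?thesis
    unfolding xy wreath_mult
    by (rule wreath_carrierI[OF _ local_on_mult[OF D(2) local_on_shift[OF E(2)]]]) (use D E in simp)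
qed

lemma wreath_group: "group wreath"
proof (rule groupI)
  show "\<one>\<^bsub>wreath\<^esub> \<in> carrier wreath"
    unfolding wreath_one by (rule wreath_carrierI[OF _ local_on_const]) auto
next
  fix x y z assume *: "x \<in> carrier wreath" "y \<in> carrier wreath" "z \<in> carrier wreath"
  obtain f k g l h m where xyz: "x = (f, k)" "y = (g, l)" "z = (h, m)"
    by (cases x, cases y, cases z)
  have "f w \<in> carrier A" "g w \<in> carrier A" "h w \<in> carrier A" for w
    using * local_on_closed unfolding xyz by (metis wreath_carrierE)+
  then show "x \<otimes>\<^bsub>wreath\<^esub> y \<otimes>\<^bsub>wreath\<^esub> z = x \<otimes>\<^bsub>wreath\<^esub> (y \<otimes>\<^bsub>wreath\<^esub> z)"
    by (simp add: xyz m_assoc add.commute)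
next
  fix x assume x: "x \<in> carrier wreath"
  obtain f k where xf: "x = (f, k)" by (cases x)
  obtain D where D: "finite D" "local_on D f" using x xf wreath_carrierE by blast
  have "f w \<in> carrier A" for w using local_on_closed[OF D(2)] .
  then show "\<one>\<^bsub>wreath\<^esub> \<otimes>\<^bsub>wreath\<^esub> x = x"
    by (simp add: wreath_one xf)
  have "(\<lambda>w. inv (f (T (- k) w)), - k) \<in> carrier wreath"
    by (rule wreath_carrierI[OF _ local_on_inv[OF local_on_shift[OF D(2)]]]) (use D in simp)
  moreover have "(\<lambda>w. inv (f (T (- k) w)), - k) \<otimes>\<^bsub>wreath\<^esub> x = \<one>\<^bsub>wreath\<^esub>"
    by (simp add: wreath_one xf local_on_closed[OF D(2)])
  ultimately show "\<exists>y\<in>carrier wreath. y \<otimes>\<^bsub>wreath\<^esub> x = \<one>\<^bsub>wreath\<^esub>" by blast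
qed (rule wreath_mult_closed)

sublocale W: group wreath by (rule wreath_group)

lemma wreath_inv:
  assumes "(f, k) \<in> carrier wreath"
  shows "inv\<^bsub>wreath\<^esub> (f, k) = (\<lambda>w. inv (f (T (- k) w)), - k)"
proof -
  obtain D where D: "finite D" "local_on D f" using assms wreath_carrierE by blast
  have "(\<lambda>w. inv (f (T (- k) w)), - k) \<in> carrier wreath"
    by (rule wreath_carrierI[OF _ local_on_inv[OF local_on_shift[OF D(2)]]]) (use D in simp)
  moreover have "(\<lambda>w. inv (f (T (- k) w)), - k) \<otimes>\<^bsub>wreath\<^esub> (f, k) = \<one>\<^bsub>wreath\<^esub>"
    by (simp add: wreath_one local_on_closed[OF D(2)])
  ultimately show ?thesis using W.inv_equality assms by blast
qed

lemma translation_closed: "(\<lambda>_. \<one>, k) \<in> carrier wreath"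
  by (rule wreath_carrierI[OF finite.emptyI local_on_const]) simp

lemma translation_conj:
  assumes "(f, 0) \<in> carrier wreath"
  shows "(\<lambda>_. \<one>, k) \<otimes>\<^bsub>wreath\<^esub> (f, 0) \<otimes>\<^bsub>wreath\<^esub> inv\<^bsub>wreath\<^esub> (\<lambda>_. \<one>, k) = (\<lambda>w. f (T k w), 0)"
  using assms by (auto simp: wreath_inv[OF translation_closed] local_on_closed elim!: wreath_carrierE)

lemma bump_closed:
  assumes "finite D" "a \<in> carrier A"
  shows "(bump (cyl D w) a, k) \<in> carrier wreath"
  by (rule wreath_carrierI[OF assms(1) local_on_bump[OF assms(2)]])

lemma bump_hom:
  assumes "finite D"
  shows "group_hom A wreath (\<lambda>a. (bump (cyl D w) a, 0))"
proof (intro group_hom.intro group_hom_axioms.intro is_group wreath_group)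
  show "(\<lambda>a. (bump (cyl D w) a, 0)) \<in> hom A wreath"
    by (rule homI) (use bump_closed[OF assms] in \<open>auto simp: bump_def\<close>)
qed

lemma base_commutator:
  assumes "(f, 0) \<in> carrier wreath" "(g, 0) \<in> carrier wreath"
  shows "(f, 0) \<otimes>\<^bsub>wreath\<^esub> (g, 0) \<otimes>\<^bsub>wreath\<^esub> inv\<^bsub>wreath\<^esub> (f, 0) \<otimes>\<^bsub>wreath\<^esub> inv\<^bsub>wreath\<^esub> (g, 0) =
    (\<lambda>w. f w \<otimes> g w \<otimes> inv (f w) \<otimes> inv (g w), 0)"
  using assms by (simp add: wreath_inv)

text \<open>
  A local function is constant on each of the finitely many cylinders over \<open>D\<close>, so it is the product of
  bumps over these.
\<close>

lemma glue_bumps: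
  assumes P: "subgroup P wreath" and D: "finite D" "local_on D f"
    and bumps: "\<And>w. (bump (cyl D w) (f w), 0) \<in> P"
  shows "(f, 0) \<in> P"
proof -
  have fc: "f w \<in> carrier A" for w using local_on_closed[OF D(2)] .
  have "(\<lambda>w. if w \<in> \<Union>F then f w else \<one>, 0) \<in> P" if "finite F" "F \<subseteq> range (cyl D)" for F
    using that
  proof (induction F rule: finite_induct)
    case empty
    then show ?case using subgroup.one_closed[OF P] by (simp add: wreath_one)
  next
    case (insert c F)
    then obtain u where u: "c = cyl D u" by blast
    have disj: "v \<notin> \<Union>F" if "v \<in> c" for v
    proof
      assume "v \<in> \<Union>F"
      then obtain w where "cyl D w \<in> F" "v \<in> cyl D w" using insert.prems by blast
      then show False using that u insert.hyps(2) cyl_eq by metis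
    qed
    have "(\<lambda>w. if w \<in> \<Union>F then f w else \<one>, 0) \<otimes>\<^bsub>wreath\<^esub> (bump c (f u), 0) \<in> P"
      using insert.IH insert.prems bumps[of u] subgroup.m_closed[OF P] u by blast
    moreover have "f v = f u" if "v \<in> c" for v using D(2) that u by (auto simp: local_on_def)
    then have "(\<lambda>w. if w \<in> \<Union>F then f w else \<one>, 0) \<otimes>\<^bsub>wreath\<^esub> (bump c (f u), 0) =
        (\<lambda>w. if w \<in> \<Union>(insert c F) then f w else \<one>, 0)"
      using disj fc by (auto simp: bump_def fun_eq_iff)
    ultimately show ?case by simp
  qed
  from this[OF finite_cyls[OF D(1)] subset_refl]
  have "(\<lambda>w. if w \<in> \<Union>(range (cyl D)) then f w else \<one>, 0) \<in> P" .
  moreover have "w \<in> \<Union>(range (cyl D))" for w using in_cyl_self by blast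
  ultimately show ?thesis by simp
qed

text \<open>
  Generators are the constant functions, the functions supported on the points labelled \<open>True\<close>, and the
  translation by \<open>1\<close>. Conjugation by translations gives the functions on all cylinders over a single
  position, and commutators of these give the functions on intersections of cylinders.
\<close>

lemma wreath_finitely_generated: "finitely_generated wreath"
proof -
  define S where "S = (\<lambda>a. (\<lambda>_. a, 0 :: int)) ` carrier A \<union> (\<lambda>a. (bump {w. lab w} a, 0)) ` carrier A \<union> {(\<lambda>_. \<one>, 1)}"
  have lab: "(bump {w. lab w} a, 0) \<in> carrier wreath" if "a \<in> carrier A" for a
    by (rule wreath_carrierI[of "{0}"]) (use that in \<open>auto simp: local_on_def bump_def cyl_def\<close>)
  have "finite S" using finite_carrier by (simp add: S_def)
  have S: "S \<subseteq> carrier wreath"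
    using lab translation_closed wreath_carrierI[OF finite.emptyI local_on_const]
    by (auto simp: S_def)
  define P where "P = generate wreath S"
  have P: "subgroup P wreath" unfolding P_def by (rule W.generate_is_subgroup[OF S])
  have inP: "x \<in> P" if "x \<in> S" for x unfolding P_def using that by (rule generate.incl)
  have tr: "(\<lambda>_. \<one>, k) \<in> P" for k
  proof (induction k rule: int_induct[where k = 0])
    case base
    then show ?case using subgroup.one_closed[OF P] by (simp add: wreath_one)
  next
    case (step1 i)
    have "(\<lambda>_. \<one>, 1) \<in> P" by (rule inP) (simp add: S_def)
    from subgroup.m_closed[OF P step1(2) this] show ?case by simp
  next
    case (step2 i)
    have "(\<lambda>_. \<one>, 1) \<in> P" by (rule inP) (simp add: S_def)
    from subgroup.m_closed[OF P step2(2) subgroup.m_inv_closed[OF P this]] show ?case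
      by (simp add: wreath_inv[OF translation_closed])
  qed
  have single: "(bump (cyl {d} w) a, 0) \<in> P" if a: "a \<in> carrier A" for d w a
  proof -
    have la: "(bump {w. lab w} a, 0) \<in> P" by (rule inP) (use a in \<open>simp add: S_def\<close>)
    have ca: "(\<lambda>_. a, 0) \<in> P" by (rule inP) (use a in \<open>simp add: S_def\<close>)
    have sh: "(\<lambda>w. bump {w. lab w} a (T d w), 0) \<in> P"
      unfolding translation_conj[OF lab[OF a], symmetric]
      by (intro subgroup.m_closed[OF P] subgroup.m_inv_closed[OF P] tr la)
    show ?thesis
    proof (cases "lab (T d w)")
      case True
      then have "bump (cyl {d} w) a = (\<lambda>w. bump {w. lab w} a (T d w))"
        by (auto simp: bump_def cyl_def)
      then show ?thesis using sh by simp
    next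
      case False
      then have "(bump (cyl {d} w) a, 0) = (\<lambda>_. a, 0) \<otimes>\<^bsub>wreath\<^esub> inv\<^bsub>wreath\<^esub> (\<lambda>w. bump {w. lab w} a (T d w), 0)"
        using a subgroup.mem_carrier[OF P sh] by (auto simp: wreath_inv bump_def cyl_def fun_eq_iff)
      then show ?thesis using subgroup.m_closed[OF P ca subgroup.m_inv_closed[OF P sh]] by simp
    qed
  qed
  have bumps: "\<forall>a\<in>carrier A. (bump (cyl D w) a, 0) \<in> P" if "finite D" for D w
    using that
  proof (induction D rule: finite_induct)
    case empty
    have "(\<lambda>_. a, 0) \<in> P" if "a \<in> carrier A" for a by (rule inP) (use that in \<open>simp add: S_def\<close>)
    moreover have "bump (cyl {} w) a = (\<lambda>_. a)" for a by (auto simp: bump_def cyl_def)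
    ultimately show ?case by simp
  next
    case (insert d D)
    let ?E = "insert d D"
    have E: "finite ?E" using insert.hyps by simp
    interpret b: group_hom A wreath "\<lambda>a. (bump (cyl ?E w) a, 0)" by (rule bump_hom[OF E])
    define Q where "Q = {a \<in> carrier A. (bump (cyl ?E w) a, 0) \<in> P}"
    have Q: "subgroup Q A" unfolding Q_def by (rule b.subgroup_vimage[OF P])
    have "derived_set A (carrier A) \<subseteq> Q"
    proof clarify
      fix x y assume xy: "x \<in> carrier A" "y \<in> carrier A"
      have m: "(bump (cyl D w) x, 0) \<in> P" "(bump (cyl {d} w) y, 0) \<in> P"
        using insert.IH single xy by auto
      have "(\<lambda>v. bump (cyl D w) x v \<otimes> bump (cyl {d} w) y v \<otimes> inv (bump (cyl D w) x v) \<otimes> inv (bump (cyl {d} w) y v), 0) \<in> P"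
        unfolding base_commutator[OF subgroup.mem_carrier[OF P m(1)] subgroup.mem_carrier[OF P m(2)], symmetric]
        by (intro subgroup.m_closed[OF P] subgroup.m_inv_closed[OF P] m)
      also have "(\<lambda>v. bump (cyl D w) x v \<otimes> bump (cyl {d} w) y v \<otimes> inv (bump (cyl D w) x v) \<otimes> inv (bump (cyl {d} w) y v))
          = bump (cyl ?E w) (x \<otimes> y \<otimes> inv x \<otimes> inv y)"
        using xy by (auto simp: bump_def cyl_def fun_eq_iff)
      finally show "x \<otimes> y \<otimes> inv x \<otimes> inv y \<in> Q" using xy by (simp add: Q_def)
    qed
    then have "derived A (carrier A) \<subseteq> Q"
      unfolding derived_def by (rule generate_subgroup_incl[OF _ Q])
    then show ?case using perfect by (auto simp: Q_def)
  qed
  have "x \<in> P" if x: "x \<in> carrier wreath" for x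
  proof -
    obtain f k where fk: "x = (f, k)" by (cases x)
    obtain D where D: "finite D" "local_on D f" using x fk wreath_carrierE by blast
    have "(f, 0) \<in> P"
      by (rule glue_bumps[OF P D]) (use bumps[OF D(1)] local_on_closed[OF D(2)] in blast)
    from subgroup.m_closed[OF P this tr[of k]] show ?thesis
      using local_on_closed[OF D(2)] by (simp add: fk)
  qed
  then have "generate wreath S = carrier wreath"
    using W.generate_incl[OF S] by (auto simp: P_def)
  then show ?thesis unfolding finitely_generated_def using S \<open>finite S\<close> by blast
qed

text \<open>A normal subgroup contains either all bumps over a given cylinder or only the trivial one, as \<open>A\<close> is
  simple. Patterns whose cylinder is not dead are called alive.\<close>

definition dead :: "(('w \<Rightarrow> 'a) \<times> int) set \<Rightarrow> int set \<Rightarrow> 'w \<Rightarrow> bool"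
  where "dead K D w \<longleftrightarrow> (\<forall>a\<in>carrier A. (bump (cyl D w) a, 0) \<in> K)"

lemma dead_cong: "v \<in> cyl D w \<Longrightarrow> dead K D v \<longleftrightarrow> dead K D w"
  by (simp add: dead_def cyl_eq)

text \<open>
  If \<open>f w\<close> and \<open>b\<close> do not commute, the commutator of \<open>f\<close> with the bump of value \<open>b\<close> is a nontrivial bump in
  \<open>K\<close> over the same cylinder. The values of such bumps form a normal subgroup of \<open>A\<close>, which is then
  all of \<open>A\<close>.
\<close>

lemma dead_if_support:
  assumes K: "K \<lhd> wreath" and D: "finite D" "local_on D f" and f: "(f, 0) \<in> K" "f w \<noteq> \<one>"
  shows "dead K D w"
proof -
  interpret K: normal K wreath by (rule K)
  interpret b: group_hom A wreath "\<lambda>a. (bump (cyl D w) a, 0)" by (rule bump_hom[OF D(1)])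
  have fc: "f v \<in> carrier A" for v using local_on_closed[OF D(2)] .
  obtain b where b: "b \<in> carrier A" "f w \<otimes> b \<otimes> inv (f w) \<otimes> inv b \<noteq> \<one>"
    using ex_noncommuting[OF fc f(2)] by blast
  let ?c = "f w \<otimes> b \<otimes> inv (f w) \<otimes> inv b"
  have bc: "(bump (cyl D w) b, 0) \<in> carrier wreath" using bump_closed[OF D(1) b(1)] .
  have fcw: "(f, 0) \<in> carrier wreath" using K.subset f(1) by blast
  have "(f, 0) \<otimes>\<^bsub>wreath\<^esub> ((bump (cyl D w) b, 0) \<otimes>\<^bsub>wreath\<^esub> inv\<^bsub>wreath\<^esub> (f, 0) \<otimes>\<^bsub>wreath\<^esub> inv\<^bsub>wreath\<^esub> (bump (cyl D w) b, 0)) \<in> K"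
    by (rule K.m_closed[OF f(1) K.inv_op_closed2[OF bc K.m_inv_closed[OF f(1)]]])
  then have "(f, 0) \<otimes>\<^bsub>wreath\<^esub> (bump (cyl D w) b, 0) \<otimes>\<^bsub>wreath\<^esub> inv\<^bsub>wreath\<^esub> (f, 0) \<otimes>\<^bsub>wreath\<^esub> inv\<^bsub>wreath\<^esub> (bump (cyl D w) b, 0) \<in> K"
    using bc fcw by (simp only: W.m_assoc W.m_closed W.inv_closed)
  then have "(\<lambda>v. f v \<otimes> bump (cyl D w) b v \<otimes> inv (f v) \<otimes> inv (bump (cyl D w) b v), 0) \<in> K"
    unfolding base_commutator[OF fcw bc] .
  also have "(\<lambda>v. f v \<otimes> bump (cyl D w) b v \<otimes> inv (f v) \<otimes> inv (bump (cyl D w) b v)) = bump (cyl D w) ?c"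
    using fc b(1) D(2) by (auto simp: bump_def fun_eq_iff local_on_def)
  finally have c: "(bump (cyl D w) ?c, 0) \<in> K" .
  have "{a \<in> carrier A. (bump (cyl D w) a, 0) \<in> K} \<lhd> A" by (rule b.normal_vimage[OF K])
  moreover have "?c \<in> {a \<in> carrier A. (bump (cyl D w) a, 0) \<in> K}" using c fc b(1) by simp
  ultimately have "{a \<in> carrier A. (bump (cyl D w) a, 0) \<in> K} = carrier A"
    using simple b(2) by blast
  then show ?thesis by (auto simp: dead_def)
qed

lemma base_mem_iff:
  assumes K: "K \<lhd> wreath" and D: "finite D" "local_on D f"
  shows "(f, 0) \<in> K \<longleftrightarrow> (\<forall>w. f w \<noteq> \<one> \<longrightarrow> dead K D w)"
proof
  assume dead: "\<forall>w. f w \<noteq> \<one> \<longrightarrow> dead K D w"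
  have P: "subgroup K wreath" by (rule normal_imp_subgroup[OF K])
  show "(f, 0) \<in> K"
  proof (rule glue_bumps[OF P D])
    fix w
    show "(bump (cyl D w) (f w), 0) \<in> K"
    proof (cases "f w = \<one>")
      case True
      then have "(bump (cyl D w) (f w), 0) = \<one>\<^bsub>wreath\<^esub>" by (auto simp: bump_def wreath_one)
      then show ?thesis using subgroup.one_closed[OF P] by simp
    next
      case False
      then show ?thesis using dead local_on_closed[OF D(2)] by (auto simp: dead_def)
    qed
  qed
qed (use dead_if_support[OF assms] in blast)

lemma ex_nontrivial: "\<exists>a\<in>carrier A. a \<noteq> \<one>"
  using nontrivial by auto

lemma dead_mono:
  assumes K: "K \<lhd> wreath" and "dead K D w" "D \<subseteq> D'" "finite D'"
  shows "dead K D' w"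
proof -
  obtain a where a: "a \<in> carrier A" "a \<noteq> \<one>" using ex_nontrivial by blast
  have "local_on D' (bump (cyl D w) a)" using local_on_mono[OF local_on_bump[OF a(1)] assms(3)] .
  moreover have "(bump (cyl D w) a, 0) \<in> K" using assms(2) a by (simp add: dead_def)
  moreover have "bump (cyl D w) a w \<noteq> \<one>" using a by (simp add: bump_def)
  ultimately show ?thesis using dead_if_support[OF K assms(4)] by blast
qed

text \<open>
  If all extensions to \<open>D'\<close> of the pattern were dead, a bump over the pattern would be a product
  of bumps over dead patterns.
\<close>

lemma alive_extend:
  assumes K: "K \<lhd> wreath" and "\<not> dead K D w" "D \<subseteq> D'" "finite D'"
  shows "\<exists>v\<in>cyl D w. \<not> dead K D' v"
proof (rule ccontr)
  assume contra: "\<not> ?thesis"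
  have "(bump (cyl D w) a, 0) \<in> K" if a: "a \<in> carrier A" for a
  proof -
    have "local_on D' (bump (cyl D w) a)" using local_on_mono[OF local_on_bump[OF a] assms(3)] .
    then show ?thesis
      using base_mem_iff[OF K assms(4)] contra by (metis bump_def)
  qed
  then show False using assms(2) by (simp add: dead_def)
qed

lemma dead_shift_imp:
  assumes K: "K \<lhd> wreath" and "finite D" and dead: "dead K D (T k w)"
  shows "dead K ((\<lambda>d. d + k) ` D) w"
  unfolding dead_def
proof
  interpret K: normal K wreath by (rule K)
  fix a assume a: "a \<in> carrier A"
  have m: "(bump (cyl D (T k w)) a, 0) \<in> K" using dead a by (simp add: dead_def)
  have "(\<lambda>v. bump (cyl D (T k w)) a (T k v), 0) \<in> K"
    unfolding translation_conj[OF K.mem_carrier[OF m], symmetric]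
    by (rule K.inv_op_closed2[OF translation_closed m])
  also have "(\<lambda>v. bump (cyl D (T k w)) a (T k v)) = bump (cyl ((\<lambda>d. d + k) ` D) w) a"
    by (simp add: bump_def fun_eq_iff cyl_shift)
  finally show "(bump (cyl ((\<lambda>d. d + k) ` D) w) a, 0) \<in> K" .
qed

lemma dead_shift:
  assumes K: "K \<lhd> wreath" and "finite D"
  shows "dead K ((\<lambda>d. d + k) ` D) w \<longleftrightarrow> dead K D (T k w)"
proof
  assume "dead K ((\<lambda>d. d + k) ` D) w"
  then show "dead K D (T k w)"
    using dead_shift_imp[OF K, of "(\<lambda>d. d + k) ` D" "- k" "T k w"] assms(2)
    by (simp add: image_image)
qed (rule dead_shift_imp[OF assms])

text \<open>
  A chain of normal subgroups becomes constant once both its intersections with the group of local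
  functions and its images in \<open>\<int>\<close> are constant.
\<close>

lemma max_normal_if_base_chains_stabilise:
  assumes base: "\<And>K. (\<And>n. K n \<lhd> wreath) \<Longrightarrow> (\<And>n. K n \<subseteq> K (Suc n)) \<Longrightarrow>
    \<exists>m. \<forall>n\<ge>m. \<forall>f. (f, 0) \<in> K n \<longrightarrow> (f, 0) \<in> K m"
  shows "max_normal wreath"
  unfolding max_normal_def
proof
  assume "\<exists>K. \<forall>n. K n \<lhd> wreath \<and> K n \<subset> K (Suc n)"
  then obtain K where K: "\<And>n. K n \<lhd> wreath" and strict: "\<And>n. K n \<subset> K (Suc n)" by blast
  have mono: "K n \<subseteq> K (Suc n)" for n using strict[of n] by blast
  have chain: "K m \<subseteq> K n" if "m \<le> n" for m n
    using that by (rule lift_Suc_mono_le[of K, OF mono])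
  obtain m1 where m1: "\<And>n f. n \<ge> m1 \<Longrightarrow> (f, 0) \<in> K n \<Longrightarrow> (f, 0) \<in> K m1"
    using base[of K, OF K mono] by blast
  have P: "subgroup (K n) wreath" for n by (rule normal_imp_subgroup[OF K])
  have "\<exists>m. \<forall>n\<ge>m. snd ` K n \<subseteq> snd ` K m"
  proof (rule int_subgroup_chain_stabilises)
    show "snd ` K n \<subseteq> snd ` K (Suc n)" for n using mono by blast
    fix n j k assume "j \<in> snd ` K n" "k \<in> snd ` K n"
    then obtain f g where fg: "(f, j) \<in> K n" "(g, k) \<in> K n" by auto
    have "(f, j) \<otimes>\<^bsub>wreath\<^esub> inv\<^bsub>wreath\<^esub> (g, k) \<in> K n"
      by (intro subgroup.m_closed[OF P] subgroup.m_inv_closed[OF P] fg)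
    moreover have "snd ((f, j) \<otimes>\<^bsub>wreath\<^esub> inv\<^bsub>wreath\<^esub> (g, k)) = j - k"
      by (simp add: wreath_inv[OF subgroup.mem_carrier[OF P fg(2)]])
    ultimately show "j - k \<in> snd ` K n" by (metis imageI)
  qed
  then obtain m2 where m2: "\<And>n. n \<ge> m2 \<Longrightarrow> snd ` K n \<subseteq> snd ` K m2" by blast
  define m where "m = max m1 m2"
  have "K (Suc m) \<subseteq> K m"
  proof
    fix x assume x: "x \<in> K (Suc m)"
    obtain f k where fk: "x = (f, k)" by (cases x)
    have "k \<in> snd ` K (Suc m)" using x fk by force
    then have "k \<in> snd ` K m2" using m2[of "Suc m"] by (simp add: m_def subset_iff)
    then obtain g where "(g, k) \<in> K m2" by auto
    then have g: "(g, k) \<in> K m" using chain[of m2 m] by (auto simp: m_def)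
    then have g': "(g, k) \<in> K (Suc m)" using mono by blast
    let ?y = "x \<otimes>\<^bsub>wreath\<^esub> inv\<^bsub>wreath\<^esub> (g, k)"
    have y: "?y \<in> K (Suc m)" by (intro subgroup.m_closed[OF P] subgroup.m_inv_closed[OF P] x g')
    have "snd ?y = 0" by (simp add: fk wreath_inv[OF subgroup.mem_carrier[OF P g]])
    then obtain h where h: "?y = (h, 0)" by (metis prod.collapse)
    then have "(h, 0) \<in> K m1" using m1[of "Suc m" h] y by (simp add: m_def)
    then have "?y \<in> K m" using chain[of m1 m] h by (auto simp: m_def)
    then have "?y \<otimes>\<^bsub>wreath\<^esub> (g, k) \<in> K m" using subgroup.m_closed[OF P] g by blast
    moreover have "?y \<otimes>\<^bsub>wreath\<^esub> (g, k) = x"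
      using subgroup.mem_carrier[OF P x] subgroup.mem_carrier[OF P g]
      by (simp add: W.m_assoc del: wreath_mult)
    ultimately show "x \<in> K m" by simp
  qed
  then show False using strict[of m] by blast
qed

end

section \<open>Sequences indexed by a countable well-order\<close>

text \<open>A block of level \<open>n + 1\<close> has \<open>2 * n + 4\<close> slots. Each slot consists of room for one block of level \<open>n\<close>,
  followed by a gap of the same length.\<close>

primrec block_len :: "nat \<Rightarrow> int" where
  "block_len 0 = 1"
| "block_len (Suc n) = (2 * int n + 4) * (2 * block_len n)"

lemma block_len_ge: "int n + 1 \<le> block_len n"
proof (induction n)
  case (Suc n)
  have "int (Suc n) + 1 \<le> 2 * int n + 4" by simp
  also have "\<dots> \<le> (2 * int n + 4) * (2 * block_len n)"
    using Suc mult_left_mono[of 1 "2 * block_len n" "2 * int n + 4"] by simp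
  finally show ?case by simp
qed simp

lemma block_len_pos: "0 < block_len n"
  using block_len_ge[of n] by simp

lemma block_len_Suc_ge: "4 * block_len n \<le> block_len (Suc n)"
  using mult_right_mono[of 4 "2 * int n + 4" "2 * block_len n"] block_len_pos[of n] by simp

lemma block_len_mono: "m \<le> n \<Longrightarrow> block_len m \<le> block_len n"
proof (induction rule: dec_induct)
  case (step n)
  then show ?case using block_len_Suc_ge[of n] block_len_pos[of n] by linarith
qed simp

text \<open>Since the family starts with its greatest value, every value lies in an interval whose right end
  point is one of \<open>e 0, \<dots>, e n\<close>.\<close>

locale top_enumeration =
  fixes e :: "nat \<Rightarrow> 'o :: wellorder"
  assumes e_le_top: "e i \<le> e 0"
begin

text \<open>The points \<open>e 0, \<dots>, e n\<close> cut the order into intervals that are open on the left and closed on the right;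
  \<open>below n \<kappa>' \<kappa>\<close> states that the interval of \<open>\<kappa>'\<close> is that of \<open>\<kappa>\<close> or lies to its left.\<close>

definition below :: "nat \<Rightarrow> 'o \<Rightarrow> 'o \<Rightarrow> bool"
  where "below n \<kappa>' \<kappa> \<longleftrightarrow> (\<forall>l\<le>n. \<kappa> \<le> e l \<longrightarrow> \<kappa>' \<le> e l)"

text \<open>
  The relation states that the slot with number \<open>t\<close> of the block of level \<open>n + 1\<close> for \<open>\<kappa>\<close> contains the block
  of level \<open>n\<close> for \<open>\<kappa>'\<close>; the remaining slots are empty. The first slot makes the block for \<open>\<kappa>\<close> an initial
  part of the next one, so that the blocks converge. The next \<open>n + 1\<close> slots accommodate the blocks
  of all intervals up to that of \<open>\<kappa>\<close>. The last \<open>n + 2\<close> slots record which of \<open>e 0, \<dots>, e (n + 1)\<close> are smaller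
  than \<open>\<kappa>\<close>, so that blocks for different intervals differ.
\<close>

definition slot :: "nat \<Rightarrow> 'o \<Rightarrow> nat \<Rightarrow> 'o \<Rightarrow> bool"
  where "slot n \<kappa> t \<kappa>' \<longleftrightarrow>
    t = 0 \<and> \<kappa>' = \<kappa> \<or>
    (\<exists>j\<le>n. t = j + 1 \<and> \<kappa>' = e j \<and> below n (e j) \<kappa>) \<or>
    (\<exists>j\<le>n + 1. t = n + 2 + j \<and> \<kappa>' = \<kappa> \<and> e j < \<kappa>)"

text \<open>Sequences of zeros and ones, finite or infinite, are represented by the set of positions of their
  ones.\<close>

primrec ones :: "nat \<Rightarrow> 'o \<Rightarrow> int set" where
  "ones 0 \<kappa> = {0}"
| "ones (Suc n) \<kappa> = {i. \<exists>t \<kappa>'. slot n \<kappa> t \<kappa>' \<and> i - 2 * block_len n * int t \<in> ones n \<kappa>'}"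

text \<open>The block is required to be preceded and followed by a gap of its own length. These gaps make
  occurrences of blocks unambiguous (\<open>shows_block_unique\<close>).\<close>

definition shows_block :: "nat \<Rightarrow> 'o \<Rightarrow> int \<Rightarrow> int set \<Rightarrow> bool"
  where "shows_block n \<kappa> p x \<longleftrightarrow>
    (\<forall>i. p - block_len n \<le> i \<longrightarrow> i < p + 2 * block_len n \<longrightarrow> (i \<in> x \<longleftrightarrow> i - p \<in> ones n \<kappa>))"

text \<open>Since each block is an initial part of the next, the union is the limit of the blocks for \<open>\<kappa>\<close>.\<close>

definition limit_ones :: "'o \<Rightarrow> int set"
  where "limit_ones \<kappa> = (\<Union>n. ones n \<kappa>)"

lemma below_refl [simp]: "below n \<kappa> \<kappa>"
  by (simp add: below_def)

lemma below_trans: "below n a b \<Longrightarrow> below n b c \<Longrightarrow> below n a c"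
  by (auto simp: below_def)

lemma below_antimono: "below n a b \<Longrightarrow> m \<le> n \<Longrightarrow> below m a b"
  by (auto simp: below_def)

lemma below_if_le: "a \<le> b \<Longrightarrow> below n a b"
  by (auto simp: below_def)

lemma slot_unique: "slot n \<kappa> t a \<Longrightarrow> slot n \<kappa> t b \<Longrightarrow> a = b"
  by (auto simp: slot_def)

lemma slot_below: "slot n \<kappa> t \<kappa>' \<Longrightarrow> below n \<kappa>' \<kappa>"
  by (auto simp: slot_def)

lemma slot_less: "slot n \<kappa> t \<kappa>' \<Longrightarrow> t < 2 * n + 4"
  by (auto simp: slot_def)

lemma slot_range: "slot n \<kappa> t \<kappa>' \<Longrightarrow> \<kappa> \<in> range e \<Longrightarrow> \<kappa>' \<in> range e"
  by (auto simp: slot_def)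

lemma slot_0: "slot n \<kappa> 0 \<kappa>"
  by (simp add: slot_def)

lemma slot_end: "slot n \<kappa> t \<kappa>' \<Longrightarrow> 2 * block_len n * int t + 2 * block_len n \<le> block_len (Suc n)"
  using slot_less[of n \<kappa> t \<kappa>'] mult_left_mono[of "int t + 1" "2 * int n + 4" "2 * block_len n"]
    block_len_pos[of n] by (simp add: algebra_simps)

lemma ones_bounds: "i \<in> ones n \<kappa> \<Longrightarrow> 0 \<le> i \<and> i < block_len n"
proof (induction n arbitrary: i \<kappa>)
  case (Suc n)
  then obtain t \<kappa>' where t: "slot n \<kappa> t \<kappa>'" and i: "i - 2 * block_len n * int t \<in> ones n \<kappa>'"
    by auto
  have "0 \<le> 2 * block_len n * int t" using block_len_pos[of n] by simp
  then show ?case using Suc.IH[OF i] slot_end[OF t] block_len_pos[of n] by linarith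
qed simp

lemma zero_in_ones: "0 \<in> ones n \<kappa>"
proof (induction n)
  case (Suc n)
  then show ?case using slot_0[of n \<kappa>] by (auto intro!: exI[of _ "0::nat"] exI[of _ \<kappa>])
qed simp

text \<open>Consecutive slots start at distance twice the block length, so the gaps around a block are
  not touched by the neighbouring slots.\<close>

lemma shows_block_slot:
  assumes "slot n \<kappa> t \<kappa>'"
  shows "shows_block n \<kappa>' (2 * block_len n * int t) (ones (Suc n) \<kappa>)"
  unfolding shows_block_def
proof (intro allI impI)
  fix i assume i: "2 * block_len n * int t - block_len n \<le> i"
    "i < 2 * block_len n * int t + 2 * block_len n"
  show "i \<in> ones (Suc n) \<kappa> \<longleftrightarrow> i - 2 * block_len n * int t \<in> ones n \<kappa>'"
  proof
    assume "i \<in> ones (Suc n) \<kappa>"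
    then obtain s \<tau> where s: "slot n \<kappa> s \<tau>" and i': "i - 2 * block_len n * int s \<in> ones n \<tau>"
      by auto
    note b = ones_bounds[OF i']
    have "s = t"
    proof (rule ccontr)
      assume "s \<noteq> t"
      then consider "int s + 1 \<le> int t" | "int t + 1 \<le> int s" by linarith
      then show False
      proof cases
        case 1
        from mult_left_mono[OF this, of "2 * block_len n"] b i block_len_pos[of n]
        show False by (simp add: algebra_simps)
      next
        case 2
        from mult_left_mono[OF this, of "2 * block_len n"] b i block_len_pos[of n]
        show False by (simp add: algebra_simps)
      qed
    qed
    then show "i - 2 * block_len n * int t \<in> ones n \<kappa>'"
      using s i' slot_unique assms by blast
  qed (use assms in auto)
qed

lemma shows_block_refl: "shows_block n \<kappa> 0 (ones n \<kappa>)"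
  by (simp add: shows_block_def)

lemma shows_block_shows_block:
  assumes "shows_block n \<kappa>' q (ones m \<kappa>)" and "shows_block m \<kappa> p x"
    and "0 \<le> q" "q + block_len n \<le> block_len m" "n \<le> m"
  shows "shows_block n \<kappa>' (p + q) x"
  unfolding shows_block_def
proof (intro allI impI)
  fix i assume i: "p + q - block_len n \<le> i" "i < p + q + 2 * block_len n"
  have "block_len n \<le> block_len m" by (rule block_len_mono[OF assms(5)])
  then have "i \<in> x \<longleftrightarrow> i - p \<in> ones m \<kappa>"
    using assms(2-4) i by (simp add: shows_block_def)
  also have "\<dots> \<longleftrightarrow> i - p - q \<in> ones n \<kappa>'"
    using assms(1) i by (simp add: shows_block_def)
  finally show "i \<in> x \<longleftrightarrow> i - (p + q) \<in> ones n \<kappa>'" by (simp add: algebra_simps)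
qed

lemma shows_slot:
  assumes "slot n \<kappa> t \<kappa>'" and "shows_block (Suc n) \<kappa> p x"
  shows "shows_block n \<kappa>' (p + 2 * block_len n * int t) x"
  by (rule shows_block_shows_block[OF shows_block_slot[OF assms(1)] assms(2)])
     (use slot_end[OF assms(1)] block_len_pos[of n] in auto)

text \<open>
  The sub-block of level \<open>n\<close> around a one is reached by descending through the slots level by level.
\<close>

lemma ones_tiled:
  assumes "n \<le> m" and "i \<in> ones m \<kappa>"
  shows "\<exists>p \<kappa>'. below n \<kappa>' \<kappa> \<and> (\<kappa> \<in> range e \<longrightarrow> \<kappa>' \<in> range e) \<and> shows_block n \<kappa>' p (ones m \<kappa>) \<and>
    0 \<le> p \<and> p \<le> i \<and> i < p + block_len n \<and> p + block_len n \<le> block_len m"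
  using assms
proof (induction m arbitrary: i \<kappa> rule: dec_induct)
  case base
  then show ?case
    using shows_block_refl ones_bounds by (intro exI[of _ 0] exI[of _ \<kappa>]) auto
next
  case (step m)
  then obtain t \<mu> where t: "slot m \<kappa> t \<mu>" and i: "i - 2 * block_len m * int t \<in> ones m \<mu>"
    by auto
  obtain q \<kappa>' where q: "below n \<kappa>' \<mu>" "\<mu> \<in> range e \<longrightarrow> \<kappa>' \<in> range e"
      "shows_block n \<kappa>' q (ones m \<mu>)" "0 \<le> q" "q \<le> i - 2 * block_len m * int t"
      "i - 2 * block_len m * int t < q + block_len n" "q + block_len n \<le> block_len m"
    using step.IH[OF i] by blast
  let ?p = "2 * block_len m * int t + q"
  have "shows_block n \<kappa>' ?p (ones (Suc m) \<kappa>)"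
    using shows_block_shows_block[OF q(3) shows_block_slot[OF t] q(4,7) step.hyps(1)] .
  moreover have "below n \<kappa>' \<kappa>"
    using below_trans[OF q(1)] below_antimono[OF slot_below[OF t] step.hyps(1)] by blast
  moreover have "0 \<le> 2 * block_len m * int t" using block_len_pos[of m] by simp
  ultimately show ?case
    using q slot_end[OF t] slot_range[OF t] block_len_pos[of m]
    by (intro exI[of _ ?p] exI[of _ \<kappa>']) auto
qed

lemma ones_Suc_iff: "i < 2 * block_len n \<Longrightarrow> i \<in> ones (Suc n) \<kappa> \<longleftrightarrow> i \<in> ones n \<kappa>"
  using shows_block_slot[OF slot_0, of n \<kappa>] ones_bounds[of i n \<kappa>] ones_bounds[of i "Suc n" \<kappa>]
    block_len_pos[of n]
  by (cases "0 \<le> i") (auto simp: shows_block_def simp del: ones.simps)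

lemma ones_mono_iff:
  "m \<le> n \<Longrightarrow> i < 2 * block_len m \<Longrightarrow> i \<in> ones n \<kappa> \<longleftrightarrow> i \<in> ones m \<kappa>"
proof (induction rule: dec_induct)
  case (step n)
  then show ?case using ones_Suc_iff[of i n \<kappa>] block_len_mono[of m n] by simp
qed simp

lemma limit_ones_iff:
  assumes "i < 2 * block_len n"
  shows "i \<in> limit_ones \<kappa> \<longleftrightarrow> i \<in> ones n \<kappa>"
proof
  assume "i \<in> limit_ones \<kappa>"
  then obtain m where m: "i \<in> ones m \<kappa>" by (auto simp: limit_ones_def)
  have "i \<in> ones (max m n) \<kappa>"
    using m ones_bounds[OF m] ones_mono_iff[of m "max m n" i \<kappa>] by simp
  then show "i \<in> ones n \<kappa>" using ones_mono_iff[of n "max m n" i \<kappa>] assms by simp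
qed (auto simp: limit_ones_def)

lemma shows_block_limit_ones: "shows_block n \<kappa> 0 (limit_ones \<kappa>)"
  by (simp add: shows_block_def limit_ones_iff)

lemma limit_ones_tiled:
  assumes "i \<in> limit_ones \<kappa>"
  obtains p \<kappa>' where "below n \<kappa>' \<kappa>" "\<kappa> \<in> range e \<longrightarrow> \<kappa>' \<in> range e"
    "shows_block n \<kappa>' p (limit_ones \<kappa>)" "p \<le> i" "i < p + block_len n"
proof -
  obtain m where m: "i \<in> ones m \<kappa>" using assms by (auto simp: limit_ones_def)
  define k where "k = max m n"
  have k: "i \<in> ones k \<kappa>"
    using m ones_bounds[OF m] ones_mono_iff[of m k i \<kappa>] by (simp add: k_def)
  have "n \<le> k" by (simp add: k_def)
  from ones_tiled[OF this k] obtain p \<kappa>' where p: "below n \<kappa>' \<kappa>" "\<kappa> \<in> range e \<longrightarrow> \<kappa>' \<in> range e"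
      "shows_block n \<kappa>' p (ones k \<kappa>)" "0 \<le> p" "p \<le> i" "i < p + block_len n"
      "p + block_len n \<le> block_len k"
    by blast
  have "shows_block n \<kappa>' (0 + p) (limit_ones \<kappa>)"
    by (rule shows_block_shows_block[OF p(3) shows_block_limit_ones p(4,7) \<open>n \<le> k\<close>])
  then show ?thesis using that p by simp
qed

text \<open>Each block starts with a one in position \<open>0\<close>. If two occurrences overlap, the start of either one lies in
  the window of the other and hence inside that other block, so both start at the same place.\<close>

lemma shows_block_unique:
  assumes "shows_block n \<kappa> p x" "shows_block n \<tau> q x"
    and "p \<le> i" "i < p + block_len n" "q \<le> i" "i < q + block_len n"
  shows "p = q \<and> ones n \<kappa> = ones n \<tau>"
proof -
  have start: "p' \<le> q'"
    if "shows_block n \<mu> p' x" "shows_block n \<nu> q' x" "p' < q' + block_len n" "q' < p' + block_len n"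
    for \<mu> \<nu> p' q'
  proof -
    have "q' \<in> x" using that(2) zero_in_ones[of n \<nu>] block_len_pos[of n] by (simp add: shows_block_def)
    then have "q' - p' \<in> ones n \<mu>" using that block_len_pos[of n] by (auto simp: shows_block_def)
    then show ?thesis using ones_bounds by fastforce
  qed
  have pq: "p = q" using start[OF assms(1,2)] start[OF assms(2,1)] assms(3-6) by auto
  have "j \<in> ones n \<kappa> \<longleftrightarrow> j \<in> ones n \<tau>" for j
  proof (cases "0 \<le> j \<and> j < block_len n")
    case True
    have "j \<in> ones n \<kappa> \<longleftrightarrow> p + j \<in> x"
      using assms(1) True block_len_pos[of n] by (auto simp: shows_block_def)
    also have "\<dots> \<longleftrightarrow> j \<in> ones n \<tau>"
      using assms(2) True block_len_pos[of n] pq by (auto simp: shows_block_def)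
    finally show ?thesis .
  qed (use ones_bounds in blast)
  then show ?thesis using pq by blast
qed

text \<open>
  All choices made in the construction of a block of level \<open>n\<close> compare \<open>\<kappa>\<close> with \<open>e 0, \<dots>, e n\<close> only.
\<close>

lemma ones_cong:
  assumes "\<And>l. l \<le> n \<Longrightarrow> \<kappa> \<le> e l \<longleftrightarrow> \<tau> \<le> e l"
  shows "ones n \<kappa> = ones n \<tau>"
  using assms
proof (induction n)
  case (Suc n)
  then have IH: "ones n \<kappa> = ones n \<tau>" by simp
  have "\<exists>\<nu>'. slot n \<nu> t \<nu>' \<and> ones n \<nu>' = ones n \<mu>'"
    if "slot n \<mu> t \<mu>'" "\<And>l. l \<le> Suc n \<Longrightarrow> \<mu> \<le> e l \<longleftrightarrow> \<nu> \<le> e l" "ones n \<mu> = ones n \<nu>" for \<mu> \<nu> t \<mu>'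
  proof -
    from that(1)[unfolded slot_def] consider "t = 0" "\<mu>' = \<mu>"
      | j where "j \<le> n" "t = j + 1" "\<mu>' = e j" "below n (e j) \<mu>"
      | j where "j \<le> n + 1" "t = n + 2 + j" "\<mu>' = \<mu>" "e j < \<mu>" by blast
    then show ?thesis
    proof cases
      case 1
      then show ?thesis using that(3) slot_0 by auto
    next
      case 2
      then have "below n (e j) \<nu>" using that(2) by (auto simp: below_def)
      then show ?thesis using 2 by (intro exI[of _ "e j"]) (auto simp: slot_def)
    next
      case 3
      then have "e j < \<nu>" using that(2)[of j] by (auto simp: not_le[symmetric])
      then show ?thesis using 3 that(3) by (intro exI[of _ \<nu>]) (auto simp: slot_def)
    qed
  qed
  from this[OF _ Suc.prems IH] this[OF _ Suc.prems[symmetric] IH[symmetric]]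
  show ?case by (auto simp: set_eq_iff) metis+
qed simp

text \<open>Conversely, the interval can be read off from the last slots of the block. At level \<open>0\<close> there is
  a single interval, because \<open>e 0\<close> is the greatest of the points.\<close>

lemma below_if_ones_eq:
  assumes "ones n \<kappa> = ones n \<tau>" and "\<kappa> \<le> e 0"
  shows "below n \<kappa> \<tau>"
proof (cases n)
  case 0
  then show ?thesis using assms(2) by (simp add: below_def)
next
  case (Suc m)
  \<comment> \<open>The slot with number \<open>m + 2 + j\<close> is occupied if and only if \<open>e j < \<mu>\<close>.\<close>
  have mark: "2 * block_len m * int (m + 2 + j) \<in> ones (Suc m) \<mu> \<longleftrightarrow> e j < \<mu>" if j: "j \<le> m + 1" for j \<mu>
  proof
    assume "e j < \<mu>"
    then have "slot m \<mu> (m + 2 + j) \<mu>" using j by (auto simp: slot_def)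
    then show "2 * block_len m * int (m + 2 + j) \<in> ones (Suc m) \<mu>"
      using zero_in_ones[of m \<mu>] by (auto intro!: exI[of _ "m + 2 + j"] exI[of _ \<mu>])
  next
    assume "2 * block_len m * int (m + 2 + j) \<in> ones (Suc m) \<mu>"
    then obtain s \<nu> where s: "slot m \<mu> s \<nu>"
        and i: "2 * block_len m * int (m + 2 + j) - 2 * block_len m * int s \<in> ones m \<nu>"
      by auto
    have "2 * block_len m * (int (m + 2 + j) - int s) = 2 * block_len m * int (m + 2 + j) - 2 * block_len m * int s"
      by (simp add: algebra_simps)
    then have b: "0 \<le> 2 * block_len m * (int (m + 2 + j) - int s)" "2 * block_len m * (int (m + 2 + j) - int s) < 2 * block_len m * 1"
      using ones_bounds[OF i] block_len_pos[of m] by linarith+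
    then have "0 \<le> int (m + 2 + j) - int s" "int (m + 2 + j) - int s < 1"
      using block_len_pos[of m] by (simp_all add: zero_le_mult_iff mult_less_cancel_left)
    then have "s = m + 2 + j" by linarith
    then show "e j < \<mu>" using s j by (auto simp: slot_def)
  qed
  show ?thesis
    unfolding below_def
  proof (intro allI impI)
    fix l assume "l \<le> n" "\<tau> \<le> e l"
    then show "\<kappa> \<le> e l"
      using mark[of l \<kappa>] mark[of l \<tau>] assms(1) Suc by (simp add: not_less[symmetric] del: ones.simps)
  qed
qed

text \<open>
  An interval is represented by its right end point.
\<close>

lemma ex_representative:
  assumes "\<kappa> \<le> e 0"
  shows "\<exists>j\<le>n. \<kappa> \<le> e j \<and> (\<forall>l\<le>n. \<kappa> \<le> e l \<longleftrightarrow> e j \<le> e l)"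
proof -
  define S where "S = e ` {l. l \<le> n \<and> \<kappa> \<le> e l}"
  have "e 0 \<in> S" using assms by (auto simp: S_def)
  then have "(LEAST x. x \<in> S) \<in> S" and "\<And>x. x \<in> S \<Longrightarrow> (LEAST x. x \<in> S) \<le> x"
    by (auto intro: LeastI Least_le)
  then obtain j where "j \<le> n" "\<kappa> \<le> e j" "\<And>l. l \<le> n \<Longrightarrow> \<kappa> \<le> e l \<Longrightarrow> e j \<le> e l"
    by (auto simp: S_def)
  then show ?thesis by (intro exI[of _ j]) auto
qed

lemma shows_block_below:
  assumes "shows_block (Suc n) \<kappa> p x" and "below n \<tau> \<kappa>" and "\<tau> \<le> e 0"
  obtains q where "shows_block n \<tau> q x" "p \<le> q" "q + 2 * block_len n \<le> p + block_len (Suc n)"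
proof -
  obtain j where j: "j \<le> n" "\<tau> \<le> e j" "\<forall>l\<le>n. \<tau> \<le> e l \<longleftrightarrow> e j \<le> e l"
    using ex_representative[OF assms(3)] by blast
  then have s: "slot n \<kappa> (j + 1) (e j)"
    using assms(2) by (auto simp: slot_def below_def)
  have "ones n (e j) = ones n \<tau>" using j by (intro ones_cong) auto
  then have "shows_block n \<tau> (p + 2 * block_len n * int (j + 1)) x"
    using shows_slot[OF s assms(1)] by (simp add: shows_block_def)
  then show ?thesis using that slot_end[OF s] block_len_pos[of n] by simp
qed

end

section \<open>The wreath product over the limit sequences\<close>

locale block_wreath = finite_perfect_simple_group A + top_enumeration e
  for A :: "('a, 'b) monoid_scheme" (structure) and e :: "nat \<Rightarrow> 'o :: wellorder"
begin

text \<open>The pair \<open>(i, j)\<close> is position \<open>i\<close> in the limit sequence for \<open>e j\<close>.\<close>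

definition shift :: "int \<Rightarrow> int \<times> nat \<Rightarrow> int \<times> nat"
  where "shift k w = (fst w + k, snd w)"

definition point :: "int \<times> nat \<Rightarrow> int set"
  where "point w = limit_ones (e (snd w))"

definition label :: "int \<times> nat \<Rightarrow> bool"
  where "label w \<longleftrightarrow> fst w \<in> point w"

sublocale local_wreath A shift label
  by unfold_locales (simp_all add: shift_def)

lemma fst_shift [simp]: "fst (shift k w) = fst w + k"
  and point_shift [simp]: "point (shift k w) = point w"
  and snd_shift [simp]: "snd (shift k w) = snd w"
  by (simp_all add: shift_def point_def)

lemma label_shift: "label (shift k w) \<longleftrightarrow> fst w + k \<in> point w"
  by (simp add: label_def)

definition window :: "nat \<Rightarrow> int set"
  where "window n = {- block_len n ..< 2 * block_len n}"

definition displays :: "nat \<Rightarrow> 'o \<Rightarrow> int \<times> nat \<Rightarrow> bool"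
  where "displays n \<kappa> w \<longleftrightarrow> shows_block n \<kappa> (fst w) (point w)"

lemma finite_window [simp]: "finite (window n)"
  by (simp add: window_def)

lemma displays_iff: "displays n \<kappa> w \<longleftrightarrow> (\<forall>d\<in>window n. label (shift d w) \<longleftrightarrow> d \<in> ones n \<kappa>)"
proof
  assume s: "displays n \<kappa> w"
  show "\<forall>d\<in>window n. label (shift d w) \<longleftrightarrow> d \<in> ones n \<kappa>"
  proof
    fix d assume "d \<in> window n"
    then show "label (shift d w) \<longleftrightarrow> d \<in> ones n \<kappa>"
      using s by (auto simp: displays_def shows_block_def window_def label_shift)
  qed
next
  assume s: "\<forall>d\<in>window n. label (shift d w) \<longleftrightarrow> d \<in> ones n \<kappa>"
  show "displays n \<kappa> w"
    unfolding displays_def shows_block_def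
  proof (intro allI impI)
    fix i assume "fst w - block_len n \<le> i" "i < fst w + 2 * block_len n"
    then have "i - fst w \<in> window n" by (simp add: window_def)
    then have "label (shift (i - fst w) w) \<longleftrightarrow> i - fst w \<in> ones n \<kappa>" using s by blast
    then show "i \<in> point w \<longleftrightarrow> i - fst w \<in> ones n \<kappa>" by (simp add: label_shift)
  qed
qed

lemma displays_cyl: "displays n \<kappa> w \<Longrightarrow> v \<in> cyl (window n) w \<Longrightarrow> displays n \<kappa> v"
  by (auto simp: displays_iff cyl_def)

lemma label_if_displays: "displays n \<kappa> w \<Longrightarrow> label w"
  using zero_in_ones[of n \<kappa>] block_len_pos[of n] by (force simp: displays_iff window_def)

lemma point_tiled:
  assumes "label (shift i w)"
  obtains k \<kappa> where "displays n \<kappa> (shift k w)" "\<kappa> \<in> range e" "below n \<kappa> (e (snd w))"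
    "k \<le> i" "i < k + block_len n"
proof -
  have "fst w + i \<in> limit_ones (e (snd w))" using assms by (simp add: label_shift point_def)
  then obtain p \<kappa> where "below n \<kappa> (e (snd w))" "e (snd w) \<in> range e \<longrightarrow> \<kappa> \<in> range e"
    "shows_block n \<kappa> p (limit_ones (e (snd w)))" "p \<le> fst w + i" "fst w + i < p + block_len n"
    by (rule limit_ones_tiled[where n = n])
  then show ?thesis by (intro that[of \<kappa> "p - fst w"]) (auto simp: displays_def point_def)
qed

definition alive :: "((int \<times> nat \<Rightarrow> 'a) \<times> int) set \<Rightarrow> nat \<Rightarrow> 'o \<Rightarrow> bool"
  where "alive K n \<kappa> \<longleftrightarrow> (\<exists>w. displays n \<kappa> w \<and> \<not> dead K (window n) w)"

lemma aliveI: "displays n \<kappa> w \<Longrightarrow> \<not> dead K (window n) w \<Longrightarrow> alive K n \<kappa>"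
  unfolding alive_def by blast

lemma alive_cong: "ones n \<kappa> = ones n \<tau> \<Longrightarrow> alive K n \<kappa> \<longleftrightarrow> alive K n \<tau>"
  by (simp add: alive_def displays_iff)

lemma alive_antimono: "K \<subseteq> K' \<Longrightarrow> alive K' n \<kappa> \<Longrightarrow> alive K n \<kappa>"
  unfolding alive_def dead_def by blast

lemma not_dead_shift:
  assumes K: "K \<lhd> wreath" and "\<not> dead K E w" "finite E" "(\<lambda>d. d + k) ` D \<subseteq> E"
  shows "\<not> dead K D (shift k w)"
proof -
  have fin: "finite ((\<lambda>d. d + k) ` D)" using assms(3,4) finite_subset by blast
  then have "finite D" by (rule finite_imageD) simp
  moreover have "\<not> dead K ((\<lambda>d. d + k) ` D) w" using dead_mono[OF K _ assms(4,3)] assms(2) by blast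
  ultimately show ?thesis using dead_shift[OF K] by blast
qed

text \<open>An alive pattern extends to an alive pattern on an interval long enough to contain, with their gaps, all
  blocks of level \<open>n\<close> that meet \<open>{-r..r}\<close>. Subpatterns of alive patterns are alive.\<close>

lemma alive_nearby:
  assumes K: "K \<lhd> wreath" and "\<not> dead K D w" "D \<subseteq> {-r..r}"
  obtains v where "v \<in> cyl D w"
    "\<And>i. \<bar>i\<bar> \<le> r \<Longrightarrow> label (shift i v) \<Longrightarrow>
      \<exists>k \<kappa>. displays n \<kappa> (shift k v) \<and> alive K n \<kappa> \<and> \<kappa> \<in> range e \<and> k \<le> i \<and> i < k + block_len n"
proof -
  define R where "R = r + 3 * block_len n"
  have "D \<subseteq> {-R..R}" using assms(3) block_len_pos[of n] by (auto simp: R_def)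
  then obtain v where v: "v \<in> cyl D w" "\<not> dead K {-R..R} v"
    using alive_extend[OF K assms(2)] by blast
  have "\<exists>k \<kappa>. displays n \<kappa> (shift k v) \<and> alive K n \<kappa> \<and> \<kappa> \<in> range e \<and> k \<le> i \<and> i < k + block_len n"
    if i: "\<bar>i\<bar> \<le> r" "label (shift i v)" for i
  proof -
    obtain k \<kappa> where k: "displays n \<kappa> (shift k v)" "\<kappa> \<in> range e" "k \<le> i" "i < k + block_len n"
      using point_tiled[OF i(2), of n] by metis
    have "(\<lambda>d. d + k) ` window n \<subseteq> {-R..R}"
      using k(3,4) i(1) block_len_pos[of n] by (auto simp: window_def R_def)
    then have "\<not> dead K (window n) (shift k v)"
      using not_dead_shift[OF K v(2)] by simp
    then have "alive K n \<kappa>" by (rule aliveI[OF k(1)])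
    then show ?thesis using k by blast
  qed
  then show ?thesis using that v(1) by blast
qed

text \<open>The block of level \<open>n + 1\<close> contains the blocks of all lower intervals, and subpatterns of alive
  patterns are alive.\<close>

lemma alive_below_Suc:
  assumes K: "K \<lhd> wreath" and "alive K (Suc n) \<kappa>" "below n \<tau> \<kappa>" "\<tau> \<in> range e"
  shows "alive K n \<tau>"
proof -
  obtain w where w: "displays (Suc n) \<kappa> w" "\<not> dead K (window (Suc n)) w"
    using assms(2) by (auto simp: alive_def)
  have "\<tau> \<le> e 0" using assms(4) e_le_top by auto
  then obtain q where q: "shows_block n \<tau> q (point w)" "fst w \<le> q"
      "q + 2 * block_len n \<le> fst w + block_len (Suc n)"
    using shows_block_below[OF w(1)[unfolded displays_def] assms(3)] by metis
  have "(\<lambda>d. d + (q - fst w)) ` window n \<subseteq> window (Suc n)"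
    using q(2,3) block_len_pos[of n] block_len_Suc_ge[of n] unfolding window_def by (auto simp del: block_len.simps)
  then have "\<not> dead K (window n) (shift (q - fst w) w)"
    using not_dead_shift[OF K w(2)] by simp
  moreover have "displays n \<tau> (shift (q - fst w) w)" using q(1) by (simp add: displays_def)
  ultimately show ?thesis using aliveI by blast
qed

text \<open>
  Extending an alive block of level \<open>n\<close> far enough reveals the block of level \<open>n + 1\<close> around it. The block of
  level \<open>n\<close> sits in one of the slots of the latter, by unambiguity of occurrences.
\<close>

lemma alive_lift_Suc:
  assumes K: "K \<lhd> wreath" and "alive K n \<kappa>" "\<kappa> \<in> range e"
  shows "\<exists>\<tau>\<in>range e. alive K (Suc n) \<tau> \<and> below n \<kappa> \<tau>"
proof -
  obtain w where w: "displays n \<kappa> w" "\<not> dead K (window n) w"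
    using assms(2) by (auto simp: alive_def)
  have "window n \<subseteq> {- (2 * block_len n)..2 * block_len n}"
    using block_len_pos[of n] by (auto simp: window_def)
  from alive_nearby[OF K w(2) this, of "Suc n"] obtain v where v: "v \<in> cyl (window n) w"
    "\<And>i. \<bar>i\<bar> \<le> 2 * block_len n \<Longrightarrow> label (shift i v) \<Longrightarrow>
      \<exists>k \<tau>. displays (Suc n) \<tau> (shift k v) \<and> alive K (Suc n) \<tau> \<and> \<tau> \<in> range e \<and> k \<le> i \<and> i < k + block_len (Suc n)"
    by blast
  have sv: "displays n \<kappa> v" by (rule displays_cyl[OF w(1) v(1)])
  have "\<bar>0\<bar> \<le> 2 * block_len n" "label (shift 0 v)"
    using label_if_displays[OF sv] block_len_pos[of n] by simp_all
  from v(2)[OF this] obtain k \<tau> where k: "displays (Suc n) \<tau> (shift k v)" "alive K (Suc n) \<tau>"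
      "\<tau> \<in> range e" "k \<le> 0" "0 < k + block_len (Suc n)"
    by blast
  have "label (shift (- k) (shift k v))" using label_if_displays[OF sv] by simp
  moreover have "- k \<in> window (Suc n)" using k(4,5) block_len_pos[of "Suc n"]
    by (simp add: window_def del: block_len.simps)
  ultimately have "- k \<in> ones (Suc n) \<tau>" using k(1) unfolding displays_iff by blast
  then obtain t \<mu> where t: "slot n \<tau> t \<mu>" and m: "- k - 2 * block_len n * int t \<in> ones n \<mu>"
    by auto
  have "shows_block n \<mu> (fst (shift k v) + 2 * block_len n * int t) (point v)"
    using shows_slot[OF t] k(1) by (simp add: displays_def)
  moreover have "shows_block n \<kappa> (fst v) (point v)" using sv by (simp add: displays_def)
  ultimately have "ones n \<mu> = ones n \<kappa>"
    using shows_block_unique[of n \<mu> _ "point v" \<kappa> "fst v" "fst v"] ones_bounds[OF m] block_len_pos[of n]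
    by (simp add: algebra_simps)
  then have "below n \<kappa> \<mu>" using below_if_ones_eq[of n \<kappa> \<mu>] assms(3) e_le_top by auto
  then have "below n \<kappa> \<tau>" using below_trans slot_below[OF t] by blast
  then show ?thesis using k by blast
qed

lemma alive_below:
  assumes K: "K \<lhd> wreath" and "alive K n \<kappa>" "\<kappa> \<in> range e" "below n \<tau> \<kappa>" "\<tau> \<in> range e"
  shows "alive K n \<tau>"
  using alive_lift_Suc[OF assms(1-3)] alive_below_Suc[OF K] below_trans assms(4,5) by metis

lemma alive_level_antimono:
  assumes K: "K \<lhd> wreath" and "\<kappa> \<in> range e" "m \<le> n" "alive K n \<kappa>"
  shows "alive K m \<kappa>"
  using assms(3,4)
  by (induction rule: dec_induct) (use alive_below_Suc[OF K] assms(2) in auto)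

lemma alive_lift:
  assumes K: "K \<lhd> wreath" and "\<kappa> \<in> range e" "m \<le> n" "alive K m \<kappa>"
  shows "\<exists>\<tau>\<in>range e. alive K n \<tau> \<and> below m \<kappa> \<tau>"
  using assms(3,4)
proof (induction rule: dec_induct)
  case base
  then show ?case using assms(2) below_refl by blast
next
  case (step n)
  then obtain \<tau> where t: "\<tau> \<in> range e" "alive K n \<tau>" "below m \<kappa> \<tau>" by blast
  then obtain \<mu> where "\<mu> \<in> range e" "alive K (Suc n) \<mu>" "below n \<tau> \<mu>"
    using alive_lift_Suc[OF K] by blast
  then show ?case using t(3) below_trans below_antimono step.hyps(1) by blast
qed

lemma alive_representative:
  assumes "alive K n \<kappa>" "\<kappa> \<in> range e"
  shows "\<exists>j\<le>n. \<kappa> \<le> e j \<and> alive K n (e j)"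
proof -
  have "\<kappa> \<le> e 0" using assms(2) e_le_top by auto
  then obtain j where j: "j \<le> n" "\<kappa> \<le> e j" "\<forall>l\<le>n. \<kappa> \<le> e l \<longleftrightarrow> e j \<le> e l"
    using ex_representative by blast
  then have "ones n \<kappa> = ones n (e j)" by (intro ones_cong) auto
  then show ?thesis using j assms(1) alive_cong by blast
qed

text \<open>The zero sequence is a limit of translates of the limit sequences. The barren subgroups are those for
  which at most its patterns are alive.\<close>

definition barren :: "((int \<times> nat \<Rightarrow> 'a) \<times> int) set \<Rightarrow> bool"
  where "barren K \<longleftrightarrow> (\<exists>n. \<forall>\<kappa>\<in>range e. \<not> alive K n \<kappa>)"

definition bounds :: "((int \<times> nat \<Rightarrow> 'a) \<times> int) set \<Rightarrow> 'o \<Rightarrow> bool"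
  where "bounds K \<mu> \<longleftrightarrow> (\<forall>n. \<forall>\<kappa>\<in>range e. alive K n \<kappa> \<longrightarrow> below n \<kappa> \<mu>)"

text \<open>For a normal subgroup that is not barren, this ordinal determines the alive blocks
  (\<open>alive_iff_below_height\<close>).\<close>

definition height :: "((int \<times> nat \<Rightarrow> 'a) \<times> int) set \<Rightarrow> 'o"
  where "height K = (LEAST \<mu>. bounds K \<mu>)"

lemma bounds_height: "bounds K (height K)"
  unfolding height_def
proof (rule LeastI)
  show "bounds K (e 0)" using e_le_top by (auto simp: bounds_def below_def intro: order_trans)
qed

lemma height_antimono:
  assumes "K \<subseteq> K'" shows "height K' \<le> height K"
proof -
  have "bounds K' (height K)"
    using bounds_height[of K] alive_antimono[OF assms] by (auto simp: bounds_def)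
  then show ?thesis unfolding height_def[of K'] by (rule Least_le)
qed

text \<open>
  Suppose that an interval of level \<open>n\<close> up to that of the height is not alive. Let \<open>\<nu>\<close> be the right end point of
  the last alive interval of level \<open>n\<close>. It is smaller than the height, since alive intervals are closed
  downwards. But \<open>\<nu>\<close> is a bound: an alive interval of another level that violates it would
  give rise, on level \<open>n\<close>, to an alive interval beyond \<open>\<nu>\<close>.
\<close>

lemma alive_iff_below_height:
  assumes K: "K \<lhd> wreath" and "\<not> barren K" and \<kappa>: "\<kappa> \<in> range e"
  shows "alive K n \<kappa> \<longleftrightarrow> below n \<kappa> (height K)"
proof
  assume "alive K n \<kappa>"
  then show "below n \<kappa> (height K)" using bounds_height \<kappa> by (auto simp: bounds_def)
next
  assume b: "below n \<kappa> (height K)"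
  show "alive K n \<kappa>"
  proof (rule ccontr)
    assume not_alive: "\<not> alive K n \<kappa>"
    define S where "S = e ` {j. j \<le> n \<and> alive K n (e j)}"
    have "finite S" by (simp add: S_def)
    obtain \<kappa>\<^sub>0 where "\<kappa>\<^sub>0 \<in> range e" "alive K n \<kappa>\<^sub>0"
      using assms(2) unfolding barren_def by blast
    then have "S \<noteq> {}" using alive_representative[of K n \<kappa>\<^sub>0] by (auto simp: S_def)
    define \<nu> where "\<nu> = Max S"
    have "\<nu> \<in> S" unfolding \<nu>_def by (rule Max_in[OF \<open>finite S\<close> \<open>S \<noteq> {}\<close>])
    then have \<nu>: "alive K n \<nu>" "\<nu> \<in> range e" by (auto simp: S_def)
    have le_\<nu>: "\<tau> \<le> \<nu>" if \<tau>: "alive K n \<tau>" "\<tau> \<in> range e" for \<tau>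
    proof -
      obtain j where j: "j \<le> n" "\<tau> \<le> e j" "alive K n (e j)" using alive_representative[OF \<tau>] by blast
      then have "e j \<le> \<nu>" unfolding \<nu>_def using \<open>finite S\<close> by (intro Max_ge) (auto simp: S_def)
      then show ?thesis using j(2) by simp
    qed
    have "\<nu> < height K"
    proof (rule ccontr)
      assume "\<not> \<nu> < height K"
      then have "below n \<kappa> \<nu>" using below_trans[OF b] below_if_le by auto
      then show False using alive_below[OF K \<nu>] \<kappa> not_alive by blast
    qed
    then have "\<not> bounds K \<nu>" unfolding height_def by (rule not_less_Least)
    then obtain m \<tau> where t: "\<tau> \<in> range e" "alive K m \<tau>" "\<not> below m \<tau> \<nu>" by (auto simp: bounds_def)
    then obtain l where l: "l \<le> m" "\<nu> \<le> e l" "\<not> \<tau> \<le> e l" by (auto simp: below_def)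
    show False
    proof (cases "n \<le> m")
      case True
      then show False using le_\<nu>[OF alive_level_antimono[OF K t(1) True t(2)] t(1)] l by simp
    next
      case False
      then obtain \<mu> where "\<mu> \<in> range e" "alive K n \<mu>" "below m \<tau> \<mu>"
        using alive_lift[OF K t(1) _ t(2), of n] by auto
      then show False using le_\<nu>[of \<mu>] l by (auto simp: below_def)
    qed
  qed
qed

lemma not_dead_if_in_block:
  assumes K: "K \<lhd> wreath" and "alive K n \<kappa>"
    and range: "\<And>d. d \<in> D \<Longrightarrow> d - k \<in> window n"
    and pattern: "\<And>d. d \<in> D \<Longrightarrow> label (shift d v) \<longleftrightarrow> d - k \<in> ones n \<kappa>"
  shows "\<not> dead K D v"
proof -
  obtain u where u: "displays n \<kappa> u" "\<not> dead K (window n) u" using assms(2) by (auto simp: alive_def)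
  have "(\<lambda>d. d + - k) ` D \<subseteq> window n" using range by auto
  then have nd: "\<not> dead K D (shift (- k) u)" using not_dead_shift[OF K u(2)] by simp
  have "shift (- k) u \<in> cyl D v"
    unfolding cyl_def
  proof clarify
    fix d assume d: "d \<in> D"
    have "label (shift d (shift (- k) u)) \<longleftrightarrow> label (shift (d - k) u)" by simp
    also have "\<dots> \<longleftrightarrow> d - k \<in> ones n \<kappa>" using u(1) range[OF d] by (simp add: displays_iff)
    finally show "label (shift d (shift (- k) u)) = label (shift d v)" using pattern[OF d] by simp
  qed
  then show ?thesis using nd dead_cong by blast
qed

lemma finite_int_bounded:
  fixes D :: "int set" assumes "finite D" obtains r where "0 \<le> r" "D \<subseteq> {-r..r}"
proof
  let ?r = "Max (insert 0 (abs ` D))"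
  show "0 \<le> ?r" using assms by simp
  show "D \<subseteq> {- ?r..?r}"
  proof
    fix d assume "d \<in> D"
    then have "\<bar>d\<bar> \<le> ?r" using assms by (intro Max_ge) auto
    then show "d \<in> {- ?r..?r}" by auto
  qed
qed

text \<open>
  A pattern shorter than the gaps of level \<open>n\<close> meets at most one block of that level and is contained in
  this block with its gaps. If it meets no block, it consists of zeros only, and it is
  contained in the gap before any block, for instance one that is alive for \<open>K\<close>. Therefore the alive
  blocks determine the alive patterns.
\<close>

lemma dead_if_alive_mono:
  assumes K: "K \<lhd> wreath" "\<not> barren K" and K': "K' \<lhd> wreath"
    and imp: "\<And>n \<kappa>. \<kappa> \<in> range e \<Longrightarrow> alive K' n \<kappa> \<Longrightarrow> alive K n \<kappa>"
    and D: "finite D" and dead: "dead K D w"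
  shows "dead K' D w"
proof (rule ccontr)
  assume nd: "\<not> dead K' D w"
  obtain r where r: "0 \<le> r" "D \<subseteq> {-r..r}" using finite_int_bounded[OF D] by blast
  \<comment> \<open>A level whose gaps are longer than the interval \<open>{-r..r}\<close>.\<close>
  define n where "n = nat (2 * r + 1)"
  have len: "2 * r + 1 < block_len n" using block_len_ge[of n] r(1) by (simp add: n_def)
  from alive_nearby[OF K' nd r(2), of n] obtain v where v: "v \<in> cyl D w"
    "\<And>i. \<bar>i\<bar> \<le> r \<Longrightarrow> label (shift i v) \<Longrightarrow>
      \<exists>k \<kappa>. displays n \<kappa> (shift k v) \<and> alive K' n \<kappa> \<and> \<kappa> \<in> range e \<and> k \<le> i \<and> i < k + block_len n"
    by blast
  have "\<not> dead K D v"
  proof (cases "\<exists>i. \<bar>i\<bar> \<le> r \<and> label (shift i v)")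
    case True
    then obtain i where i: "\<bar>i\<bar> \<le> r" "label (shift i v)" by blast
    from v(2)[OF this] obtain k \<kappa> where k: "displays n \<kappa> (shift k v)" "alive K' n \<kappa>" "\<kappa> \<in> range e"
      "k \<le> i" "i < k + block_len n" by blast
    have win: "d - k \<in> window n" if "d \<in> D" for d
    proof -
      have "-r \<le> d" "d \<le> r" using that r(2) by auto
      then show ?thesis using k(4,5) i(1) len by (auto simp: window_def)
    qed
    show ?thesis
    proof (rule not_dead_if_in_block[OF K(1) imp[OF k(3,2)] win])
      fix d assume d: "d \<in> D"
      have "label (shift (d - k) (shift k v)) \<longleftrightarrow> d - k \<in> ones n \<kappa>"
        using k(1) win[OF d] by (simp only: displays_iff)
      then show "label (shift d v) \<longleftrightarrow> d - k \<in> ones n \<kappa>" by simp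
    qed
  next
    case False
    obtain \<kappa> where \<kappa>: "alive K n \<kappa>" using K(2) by (auto simp: barren_def)
    show ?thesis
      \<comment> \<open>The interval \<open>{-r..r}\<close> is placed into the gap immediately before the block.\<close>
    proof (rule not_dead_if_in_block[OF K(1) \<kappa>, of D "r + 1"])
      fix d assume "d \<in> D"
      then have d: "-r \<le> d" "d \<le> r" using r(2) by auto
      then show "d - (r + 1) \<in> window n" using len by (auto simp: window_def)
      have "\<not> label (shift d v)" using False d by auto
      moreover have "d - (r + 1) \<notin> ones n \<kappa>" using ones_bounds[of "d - (r + 1)" n \<kappa>] d by auto
      ultimately show "label (shift d v) \<longleftrightarrow> d - (r + 1) \<in> ones n \<kappa>" by simp
    qed
  qed
  then show False using dead v(1) dead_cong by blast
qed

lemma barren_not_dead_imp_zero: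
  assumes K: "K \<lhd> wreath" "barren K" and "finite D" "\<not> dead K D w" "d \<in> D"
  shows "\<not> label (shift d w)"
proof
  assume lab: "label (shift d w)"
  obtain n where n: "\<And>\<kappa>. \<kappa> \<in> range e \<Longrightarrow> \<not> alive K n \<kappa>" using K(2) by (auto simp: barren_def)
  obtain r where r: "0 \<le> r" "D \<subseteq> {-r..r}" using finite_int_bounded[OF assms(3)] by blast
  from alive_nearby[OF K(1) assms(4) r(2), of n] obtain v where v: "v \<in> cyl D w"
    "\<And>i. \<bar>i\<bar> \<le> r \<Longrightarrow> label (shift i v) \<Longrightarrow>
      \<exists>k \<kappa>. displays n \<kappa> (shift k v) \<and> alive K n \<kappa> \<and> \<kappa> \<in> range e \<and> k \<le> i \<and> i < k + block_len n"
    by blast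
  have "label (shift d v)" using v(1) lab assms(5) by (simp add: cyl_def)
  moreover have "d \<in> {-r..r}" using r(2) assms(5) by blast
  then have "\<bar>d\<bar> \<le> r" by auto
  ultimately show False using v(2) n by blast
qed

text \<open>An alive pattern could be extended to the positions of the dead zero pattern, and for a barren
  subgroup the extension consists of zeros, so it would contain the dead pattern.\<close>

lemma barren_all_dead:
  assumes K: "K \<lhd> wreath" "barren K"
    and D: "finite D" "dead K D w" "\<And>d. d \<in> D \<Longrightarrow> \<not> label (shift d w)"
    and E: "finite E"
  shows "dead K E v"
proof (rule ccontr)
  assume "\<not> dead K E v"
  then obtain u where u: "\<not> dead K (E \<union> D) u"
    using alive_extend[OF K(1), of E v "E \<union> D"] D(1) E by auto
  have "u \<in> cyl D w"
    using barren_not_dead_imp_zero[OF K _ u] D(1,3) E by (auto simp: cyl_def)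
  then have "dead K D u" using D(2) dead_cong by blast
  then have "dead K (E \<union> D) u" using dead_mono[OF K(1)] D(1) E by (metis Un_upper2 finite_UnI)
  then show False using u by blast
qed

text \<open>
  In a chain without barren members the heights decrease and so become constant; the alive blocks, and
  with them the alive patterns, are then constant as well. If there is a barren member, only zero
  patterns can be alive from there on, and as soon as one of these is dead, all patterns are.
\<close>

theorem max_normal_wreath: "max_normal wreath"
proof (rule max_normal_if_base_chains_stabilise)
  fix K assume K: "\<And>n. K n \<lhd> wreath" and mono: "\<And>n. K n \<subseteq> K (Suc n)"
  have chain: "K m \<subseteq> K n" if "m \<le> n" for m n
    using that by (rule lift_Suc_mono_le[of K, OF mono])
  have transfer: "(f, 0) \<in> K m"
    if "(f, 0) \<in> K n" and imp: "\<And>D w. finite D \<Longrightarrow> dead (K n) D w \<Longrightarrow> dead (K m) D w" for f m n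
  proof -
    have "(f, 0) \<in> carrier wreath" 
      by (rule subgroup.mem_carrier[OF normal_imp_subgroup[OF K] that(1)])
    then obtain D where D: "finite D" "local_on D f" by (rule wreath_carrierE)
    have "\<forall>w. f w \<noteq> \<one> \<longrightarrow> dead (K n) D w" using base_mem_iff[OF K D] that(1) by (rule iffD1)
    then have "\<forall>w. f w \<noteq> \<one> \<longrightarrow> dead (K m) D w" using imp[OF D(1)] by simp
    with base_mem_iff[OF K D] show ?thesis by (rule iffD2)
  qed
  have "\<exists>m. \<forall>n\<ge>m. \<forall>D w. finite D \<longrightarrow> dead (K n) D w \<longrightarrow> dead (K m) D w"
  proof (cases "\<exists>j. barren (K j)")
    case True
    then obtain j where "barren (K j)" by blast
    then have barren: "barren (K n)" if "j \<le> n" for n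
      using alive_antimono[OF chain[OF that]] by (auto simp: barren_def)
    show ?thesis
    proof (cases "\<exists>m\<ge>j. \<exists>D w. finite D \<and> dead (K m) D w \<and> (\<forall>d\<in>D. \<not> label (shift d w))")
      case True
      then obtain m D w where m: "j \<le> m" "finite D" "dead (K m) D w" "\<forall>d\<in>D. \<not> label (shift d w)"
        by blast
      then have "dead (K m) E v" if "finite E" for E v
        using barren_all_dead[OF K barren[OF m(1)]] that by blast
      then show ?thesis by blast
    next
      case False
      have "dead (K j) D w" if n: "j \<le> n" and D: "finite D" "dead (K n) D w" for n D w
      proof -
        obtain d where "d \<in> D" "label (shift d w)" using False n D by blast
        then show ?thesis
          using barren_not_dead_imp_zero[OF K barren[OF order_refl] D(1), of w d] by metis
      qed
      then show ?thesis by blast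
    qed
  next
    case False
    define \<mu> where "\<mu> = (LEAST \<mu>. \<mu> \<in> range (\<lambda>n. height (K n)))"
    have "\<mu> \<in> range (\<lambda>n. height (K n))" unfolding \<mu>_def by (rule LeastI[of _ "height (K 0)"]) simp
    then obtain m where m: "\<mu> = height (K m)" by blast
    have height_eq: "height (K n) = height (K m)" if "m \<le> n" for n
    proof (rule antisym[OF height_antimono[OF chain[OF that]]])
      show "height (K m) \<le> height (K n)" unfolding m[symmetric] \<mu>_def by (rule Least_le) simp
    qed
    have "dead (K m) D w" if n: "m \<le> n" and D: "finite D" "dead (K n) D w" for n D w
    proof (rule dead_if_alive_mono[OF K _ K _ D])
      show "\<not> barren (K n)" using False by blast
      show "alive (K n) l \<kappa>" if "\<kappa> \<in> range e" "alive (K m) l \<kappa>" for l \<kappa>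
        using that alive_iff_below_height[OF K _ that(1)] False height_eq[OF n] by simp
    qed
    then show ?thesis by (intro exI[of _ m] allI impI)
  qed
  then obtain m where m: "\<forall>n\<ge>m. \<forall>D w. finite D \<longrightarrow> dead (K n) D w \<longrightarrow> dead (K m) D w" ..
  show "\<exists>m. \<forall>n\<ge>m. \<forall>f. (f, 0) \<in> K n \<longrightarrow> (f, 0) \<in> K m"
  proof (intro exI allI impI)
    fix n f assume "m \<le> n" and f: "(f, 0) \<in> K n"
    then show "(f, 0) \<in> K m" using m by (intro transfer[OF f]) blast
  qed
qed

definition vanishing :: "'o \<Rightarrow> ((int \<times> nat \<Rightarrow> 'a) \<times> int) set"
  where "vanishing \<beta> =
    {x \<in> carrier wreath. snd x = 0 \<and> (\<forall>w. e (snd w) \<le> \<beta> \<longrightarrow> fst x w = \<one>)}"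

lemma vanishing_normal: "vanishing \<beta> \<lhd> wreath"
  unfolding W.normal_inv_iff
proof (intro conjI ballI)
  show "subgroup (vanishing \<beta>) wreath"
  proof
    show "vanishing \<beta> \<subseteq> carrier wreath" by (auto simp: vanishing_def)
    show "\<one>\<^bsub>wreath\<^esub> \<in> vanishing \<beta>" using W.one_closed by (simp add: vanishing_def wreath_one)
    fix x assume x: "x \<in> vanishing \<beta>"
    then obtain f where f: "x = (f, 0)" "(f, 0) \<in> carrier wreath" "\<And>w. e (snd w) \<le> \<beta> \<Longrightarrow> f w = \<one>"
      by (cases x) (auto simp: vanishing_def)
    show "inv\<^bsub>wreath\<^esub> x \<in> vanishing \<beta>"
      using f W.inv_closed[OF f(2)] by (simp add: vanishing_def wreath_inv)
    fix y assume "y \<in> vanishing \<beta>"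
    then obtain g where g: "y = (g, 0)" "(g, 0) \<in> carrier wreath" "\<And>w. e (snd w) \<le> \<beta> \<Longrightarrow> g w = \<one>"
      by (cases y) (auto simp: vanishing_def)
    show "x \<otimes>\<^bsub>wreath\<^esub> y \<in> vanishing \<beta>"
      using f g W.m_closed[OF f(2) g(2)] by (simp add: vanishing_def)
  qed
next
  fix x h assume x: "x \<in> carrier wreath" and h: "h \<in> vanishing \<beta>"
  obtain g k where g: "x = (g, k)" by (cases x)
  obtain f where f: "h = (f, 0)" "(f, 0) \<in> carrier wreath" "\<And>w. e (snd w) \<le> \<beta> \<Longrightarrow> f w = \<one>"
    using h by (cases h) (auto simp: vanishing_def)
  have gc: "g w \<in> carrier A" for w using x g local_on_closed by (metis wreath_carrierE)
  have "x \<otimes>\<^bsub>wreath\<^esub> h \<otimes>\<^bsub>wreath\<^esub> inv\<^bsub>wreath\<^esub> x \<in> carrier wreath"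
    using x f(1,2) by (intro W.m_closed W.inv_closed) simp_all
  moreover have "x \<otimes>\<^bsub>wreath\<^esub> h \<otimes>\<^bsub>wreath\<^esub> inv\<^bsub>wreath\<^esub> x = (\<lambda>w. g w \<otimes> f (shift k w) \<otimes> inv (g w), 0)"
    using x by (simp add: g f(1) wreath_inv)
  ultimately show "x \<otimes>\<^bsub>wreath\<^esub> h \<otimes>\<^bsub>wreath\<^esub> inv\<^bsub>wreath\<^esub> x \<in> vanishing \<beta>"
    using f(3) gc by (simp add: vanishing_def)
qed

text \<open>
  A block of level \<open>l\<close> for \<open>\<beta>' > \<beta> = e l\<close> does not occur in the limit sequences up to \<open>\<beta>\<close>, so a bump over this
  block vanishes on all of them, but not on the limit sequence for \<open>\<beta>'\<close>.
\<close>

lemma vanishing_strict: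
  assumes "\<beta> < \<beta>'" "\<beta> \<in> range e" "\<beta>' \<in> range e"
  shows "vanishing \<beta>' \<subset> vanishing \<beta>"
proof
  show "vanishing \<beta>' \<subseteq> vanishing \<beta>" using assms(1) by (auto simp: vanishing_def)
  obtain l j where l: "\<beta> = e l" and j: "\<beta>' = e j" using assms by blast
  obtain a where a: "a \<in> carrier A" "a \<noteq> \<one>" using ex_nontrivial by blast
  let ?w = "(0, j)" and ?f = "bump (cyl (window l) (0, j)) a"
  have sw: "displays l \<beta>' ?w"
    using shows_block_limit_ones by (simp add: displays_def point_def j)
  have "?f v = \<one>" if "e (snd v) \<le> \<beta>" for v
  proof (rule ccontr)
    assume "?f v \<noteq> \<one>"
    then have "v \<in> cyl (window l) ?w" by (auto simp: bump_def split: if_splits)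
    then have sv: "displays l \<beta>' v" by (rule displays_cyl[OF sw])
    then have "label (shift 0 v)" using label_if_displays by simp
    then obtain k \<kappa> where k: "displays l \<kappa> (shift k v)" "\<kappa> \<in> range e" "below l \<kappa> (e (snd v))"
        "k \<le> 0" "0 < k + block_len l"
      by (rule point_tiled)
    have "ones l \<beta>' = ones l \<kappa>"
      using shows_block_unique[of l \<beta>' "fst v" "point v" \<kappa> "fst v + k" "fst v"] sv k block_len_pos[of l]
      by (simp add: displays_def)
    then have "below l \<beta>' \<kappa>" using below_if_ones_eq j e_le_top by blast
    moreover have "\<kappa> \<le> e l" using k(3) that l by (simp add: below_def)
    ultimately show False using assms(1) l by (auto simp: below_def)
  qed
  then have "(?f, 0) \<in> vanishing \<beta>" using bump_closed[OF finite_window a(1)] by (simp add: vanishing_def)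
  moreover have "?f ?w \<noteq> \<one>" using a(2) by (simp add: bump_def)
  then have "(?f, 0) \<notin> vanishing \<beta>'" using j by (auto simp: vanishing_def)
  ultimately show "vanishing \<beta>' \<noteq> vanishing \<beta>" by blast
qed

end

section \<open>Groups of arbitrarily large countable rank\<close>

lemma ex_enumeration_from_top:
  fixes \<alpha> :: ordinal
  assumes "\<alpha> < omega1"
  obtains e :: "nat \<Rightarrow> ordinal" where "e 0 = \<alpha>" "range e = {..\<alpha>}"
proof -
  have "countable {..<\<alpha>}" using assms by (simp add: less_omega1_iff)
  moreover have eq: "{..\<alpha>} = insert \<alpha> {..<\<alpha>}" by auto
  ultimately have c: "countable {..\<alpha>}" by simp
  define e where "e n = (case n of 0 \<Rightarrow> \<alpha> | Suc m \<Rightarrow> from_nat_into {..\<alpha>} m)" for n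
  have "{..\<alpha>} = range (from_nat_into {..\<alpha>})" using range_from_nat_into[OF _ c] by auto
  moreover have "(UNIV :: nat set) = insert 0 (range Suc)" using not0_implies_Suc by blast
  then have "range e = e ` insert 0 (range Suc)" by (rule arg_cong)
  then have "range e = insert \<alpha> (range (from_nat_into {..\<alpha>}))"
    by (simp add: e_def image_image)
  ultimately have "range e = {..\<alpha>}" by auto
  then show ?thesis using that[of e] by (simp add: e_def)
qed

theorem corollary5p17:
  fixes \<gamma> :: "nat \<Rightarrow> letter list" and \<alpha> :: ordinal
  assumes "range \<gamma> = carrier free_group_omega"
    and "\<alpha> < omega1"
  shows "\<exists>N. N \<lhd> free_group_omega \<and>
    (let G = free_group_omega Mod N; g = (\<lambda>i. N #>\<^bsub>free_group_omega\<^esub> \<gamma> i) in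
      finitely_generated G \<and> max_normal G \<and>
      \<alpha> \<le> tree_rank (normal_subgroup_tree G g))"
proof -
  obtain A :: "(nat \<Rightarrow> nat) set monoid" where A: "finite_perfect_simple_group A"
    using ex_finite_perfect_simple_group by blast
  obtain e :: "nat \<Rightarrow> ordinal" where e: "e 0 = \<alpha>" "range e = {..\<alpha>}"
    by (rule ex_enumeration_from_top[OF assms(2)])
  have "top_enumeration e"
  proof
    show "e i \<le> e 0" for i using e by auto
  qed
  then interpret block_wreath A e by (intro block_wreath.intro A)
  show ?thesis
  proof (rule W.marked_quotient_of_large_rank[OF assms(1) wreath_finitely_generated max_normal_wreath])
    show "vanishing \<beta> \<lhd> wreath" for \<beta> by (rule vanishing_normal)
    show "vanishing \<beta>' \<subset> vanishing \<beta>" if "\<beta> < \<beta>'" "\<beta>' \<le> \<alpha>" for \<beta> \<beta>'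
      using that e(2) by (intro vanishing_strict) auto
  qed
qed

end
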